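(* Let $R$ be a ring, and let $I$ be a two-sided ideal of $R$ that is the trace ideal of a countably generated projective right $R$-module. Let $P'$ be a countably generated projective right module over $R/I$. Then there exists a countably generated projective right $R$-module $P$ such that $I\subseteq \mathrm{Tr}(P)$, $P/PI\cong P'$ and $\mathrm{Tr}(P)/I=\mathrm{Tr}_{R/I}(P')$.
   Context: Rings are associative with $1$. The trace ideal of a right module $P$ over a ring $S$ is the two-sided ideal $\mathrm{Tr}(P)=\mathrm{Tr}_S(P)=\sum_{f\in \mathrm{Hom}_S(P,S)}f(P)$ of $S$. *)

theory Defs
  imports "HOL-Algebra.QuotRing" "HOL-Library.Countable_Set"
begin

text \<open>
  HOL-Algebra only has modules over commutative rings. As there, a right module extends the
  ring record, whose multiplicative fields are ignored.
\<close>

record ('a, 'b) rmodule = "'b ring" +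
  rsmult :: "['b, 'a] \<Rightarrow> 'b" (infixl \<open>\<star>\<index>\<close> 70)

locale right_module = R?: ring R + M?: abelian_group M
  for R (structure) and M :: "('a, 'b, 'm) rmodule_scheme" (structure) +
  assumes rsmult_closed [simp, intro]:
      "\<lbrakk>x \<in> carrier M; a \<in> carrier R\<rbrakk> \<Longrightarrow> x \<star>\<^bsub>M\<^esub> a \<in> carrier M"
    and rsmult_l_distr:
      "\<lbrakk>x \<in> carrier M; y \<in> carrier M; a \<in> carrier R\<rbrakk> \<Longrightarrow>
       (x \<oplus>\<^bsub>M\<^esub> y) \<star>\<^bsub>M\<^esub> a = x \<star>\<^bsub>M\<^esub> a \<oplus>\<^bsub>M\<^esub> y \<star>\<^bsub>M\<^esub> a"
    and rsmult_r_distr: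
      "\<lbrakk>x \<in> carrier M; a \<in> carrier R; b \<in> carrier R\<rbrakk> \<Longrightarrow>
       x \<star>\<^bsub>M\<^esub> (a \<oplus>\<^bsub>R\<^esub> b) = x \<star>\<^bsub>M\<^esub> a \<oplus>\<^bsub>M\<^esub> x \<star>\<^bsub>M\<^esub> b"
    and rsmult_assoc:
      "\<lbrakk>x \<in> carrier M; a \<in> carrier R; b \<in> carrier R\<rbrakk> \<Longrightarrow>
       x \<star>\<^bsub>M\<^esub> (a \<otimes>\<^bsub>R\<^esub> b) = (x \<star>\<^bsub>M\<^esub> a) \<star>\<^bsub>M\<^esub> b"
    and rsmult_one [simp]: "x \<in> carrier M \<Longrightarrow> x \<star>\<^bsub>M\<^esub> \<one>\<^bsub>R\<^esub> = x"

definition regular_rmodule :: "('a, 'r) ring_scheme \<Rightarrow> ('a, 'a) rmodule" where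
  "regular_rmodule R = \<lparr>carrier = carrier R, mult = mult R, one = \<one>\<^bsub>R\<^esub>,
     zero = \<zero>\<^bsub>R\<^esub>, add = add R, rsmult = mult R\<rparr>"

definition rmod_hom ::
    "[('a, 'r) ring_scheme, ('a, 'b, 'm) rmodule_scheme, ('a, 'c, 'n) rmodule_scheme]
      \<Rightarrow> ('b \<Rightarrow> 'c) set" where
  "rmod_hom R M N = {f \<in> carrier M \<rightarrow> carrier N.
     (\<forall>x\<in>carrier M. \<forall>y\<in>carrier M. f (x \<oplus>\<^bsub>M\<^esub> y) = f x \<oplus>\<^bsub>N\<^esub> f y) \<and>
     (\<forall>x\<in>carrier M. \<forall>a\<in>carrier R. f (x \<star>\<^bsub>M\<^esub> a) = f x \<star>\<^bsub>N\<^esub> a)}"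

definition rmod_iso ::
    "[('a, 'r) ring_scheme, ('a, 'b, 'm) rmodule_scheme, ('a, 'c, 'n) rmodule_scheme]
      \<Rightarrow> bool" where
  "rmod_iso R M N \<longleftrightarrow> (\<exists>f\<in>rmod_hom R M N. bij_betw f (carrier M) (carrier N))"

text \<open>
  Projectivity is the lifting property against surjections \<open>g : M \<rightarrow> N\<close>. HOL cannot quantify
  over the types of \<open>M\<close> and \<open>N\<close> in a definition, so they are fixed, large enough to contain the
  canonical surjection from the free module on the set \<open>P\<close> onto \<open>P\<close>. The lemma
  \<open>projective_rmodule_lift\<close> below gives the lifting property for \<open>M\<close> and \<open>N\<close> of arbitrary types.
\<close>

definition projective_rmodule :: "[('a, 'r) ring_scheme, ('a, 'b) rmodule] \<Rightarrow> bool" where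
  "projective_rmodule R P \<longleftrightarrow> right_module R P \<and>
     (\<forall>(M :: ('a, 'b \<Rightarrow> 'a) rmodule) (N :: ('a, 'b) rmodule).
        right_module R M \<longrightarrow> right_module R N \<longrightarrow>
        (\<forall>g\<in>rmod_hom R M N. \<forall>f\<in>rmod_hom R P N. g ` carrier M = carrier N \<longrightarrow>
           (\<exists>h\<in>rmod_hom R P M. \<forall>x\<in>carrier P. g (h x) = f x)))"

definition finite_sums :: "[('b, 'm) ring_scheme, 'b set] \<Rightarrow> 'b set" where
  "finite_sums G X = {\<Oplus>\<^bsub>G\<^esub>i\<in>{..<n}. x i | (n :: nat) x. x \<in> {..<n} \<rightarrow> X}"

definition countably_generated_rmodule ::
    "[('a, 'r) ring_scheme, ('a, 'b, 'm) rmodule_scheme] \<Rightarrow> bool" where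
  "countably_generated_rmodule R M \<longleftrightarrow>
     (\<exists>X. countable X \<and> X \<subseteq> carrier M \<and>
        carrier M = finite_sums M {x \<star>\<^bsub>M\<^esub> a | x a. x \<in> X \<and> a \<in> carrier R})"

definition trace_ideal ::
    "[('a, 'r) ring_scheme, ('a, 'b, 'm) rmodule_scheme] \<Rightarrow> 'a set" where
  "trace_ideal R P = finite_sums R (\<Union>f\<in>rmod_hom R P (regular_rmodule R). f ` carrier P)"

definition rmod_ideal_prod ::
    "[('a, 'b, 'm) rmodule_scheme, 'a set] \<Rightarrow> 'b set" where
  "rmod_ideal_prod P I = finite_sums P {x \<star>\<^bsub>P\<^esub> a | x a. x \<in> carrier P \<and> a \<in> I}"

text \<open>
  \<open>P/PI\<close> as a right module over \<open>R Quot I\<close>; the scalar action on cosets follows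
  \<open>rcoset_mult\<close>. The multiplicative fields carry no information.
\<close>

definition quot_rmodule ::
    "[('a, 'b, 'm) rmodule_scheme, 'a set] \<Rightarrow> ('a set, 'b set) rmodule" where
  "quot_rmodule P I = (let N = rmod_ideal_prod P I in
     \<lparr>carrier = a_rcosets\<^bsub>P\<^esub> N, mult = undefined, one = undefined, zero = N, add = set_add P,
      rsmult = (\<lambda>X A. \<Union>x\<in>X. \<Union>a\<in>A. N +>\<^bsub>P\<^esub> (x \<star>\<^bsub>P\<^esub> a))\<rparr>)"


lemma rmod_homD:
  assumes "f \<in> rmod_hom R M N"
  shows "x \<in> carrier M \<Longrightarrow> f x \<in> carrier N"
    and "x \<in> carrier M \<Longrightarrow> y \<in> carrier M \<Longrightarrow> f (x \<oplus>\<^bsub>M\<^esub> y) = f x \<oplus>\<^bsub>N\<^esub> f y"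
    and "x \<in> carrier M \<Longrightarrow> a \<in> carrier R \<Longrightarrow> f (x \<star>\<^bsub>M\<^esub> a) = f x \<star>\<^bsub>N\<^esub> a"
  using assms by (auto simp: rmod_hom_def)

lemma rmod_homI:
  assumes "\<And>x. x \<in> carrier M \<Longrightarrow> f x \<in> carrier N"
    and "\<And>x y. x \<in> carrier M \<Longrightarrow> y \<in> carrier M \<Longrightarrow> f (x \<oplus>\<^bsub>M\<^esub> y) = f x \<oplus>\<^bsub>N\<^esub> f y"
    and "\<And>x a. x \<in> carrier M \<Longrightarrow> a \<in> carrier R \<Longrightarrow> f (x \<star>\<^bsub>M\<^esub> a) = f x \<star>\<^bsub>N\<^esub> a"
  shows "f \<in> rmod_hom R M N"
  using assms by (auto simp: rmod_hom_def)

context right_module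
begin

lemma rsmult_zero_left [simp]:
  assumes "a \<in> carrier R" shows "\<zero>\<^bsub>M\<^esub> \<star>\<^bsub>M\<^esub> a = \<zero>\<^bsub>M\<^esub>"
proof -
  have "\<zero>\<^bsub>M\<^esub> \<star>\<^bsub>M\<^esub> a \<oplus>\<^bsub>M\<^esub> \<zero>\<^bsub>M\<^esub> \<star>\<^bsub>M\<^esub> a = \<zero>\<^bsub>M\<^esub> \<star>\<^bsub>M\<^esub> a"
    using rsmult_l_distr[of "\<zero>\<^bsub>M\<^esub>" "\<zero>\<^bsub>M\<^esub>" a] assms by simp
  then show ?thesis
    using assms by (metis M.add.l_cancel_one rsmult_closed M.zero_closed)
qed

lemma rsmult_zero_right [simp]:
  assumes "x \<in> carrier M" shows "x \<star>\<^bsub>M\<^esub> \<zero>\<^bsub>R\<^esub> = \<zero>\<^bsub>M\<^esub>"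
proof -
  have "x \<star>\<^bsub>M\<^esub> \<zero>\<^bsub>R\<^esub> \<oplus>\<^bsub>M\<^esub> x \<star>\<^bsub>M\<^esub> \<zero>\<^bsub>R\<^esub> = x \<star>\<^bsub>M\<^esub> \<zero>\<^bsub>R\<^esub>"
    using rsmult_r_distr[of x "\<zero>\<^bsub>R\<^esub>" "\<zero>\<^bsub>R\<^esub>"] assms by simp
  then show ?thesis
    using assms by (metis M.add.l_cancel_one rsmult_closed R.zero_closed)
qed

lemma finsum_rsmult:
  assumes "a \<in> carrier R" "finite A" "f \<in> A \<rightarrow> carrier M"
  shows "(\<Oplus>\<^bsub>M\<^esub>i\<in>A. f i) \<star>\<^bsub>M\<^esub> a = (\<Oplus>\<^bsub>M\<^esub>i\<in>A. f i \<star>\<^bsub>M\<^esub> a)"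
  using assms(2,3)
proof (induction A rule: finite_induct)
  case empty
  then show ?case using assms(1) by simp
next
  case (insert x F)
  have "(\<lambda>i. f i \<star>\<^bsub>M\<^esub> a) \<in> F \<rightarrow> carrier M" "f x \<star>\<^bsub>M\<^esub> a \<in> carrier M"
    using insert.prems assms(1) by auto
  then show ?case
    using insert assms(1) by (simp add: rsmult_l_distr Pi_iff)
qed

end

text \<open>The free right module on a set \<open>X\<close>, as finitely supported functions.\<close>

definition free_rmodule :: "[('a, 'r) ring_scheme, 'b set] \<Rightarrow> ('a, 'b \<Rightarrow> 'a) rmodule" where
  "free_rmodule R X = \<lparr>
     carrier = {\<phi>. (\<forall>x. \<phi> x \<in> carrier R) \<and> finite {x. \<phi> x \<noteq> \<zero>\<^bsub>R\<^esub>} \<and> {x. \<phi> x \<noteq> \<zero>\<^bsub>R\<^esub>} \<subseteq> X},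
     mult = undefined, one = undefined, zero = (\<lambda>_. \<zero>\<^bsub>R\<^esub>),
     add = (\<lambda>\<phi> \<psi> x. \<phi> x \<oplus>\<^bsub>R\<^esub> \<psi> x), rsmult = (\<lambda>\<phi> a x. \<phi> x \<otimes>\<^bsub>R\<^esub> a)\<rparr>"

definition free_eval ::
    "[('a, 'r) ring_scheme, ('a, 'c, 'm) rmodule_scheme, 'b \<Rightarrow> 'c, 'b \<Rightarrow> 'a] \<Rightarrow> 'c" where
  "free_eval R M m \<phi> = (\<Oplus>\<^bsub>M\<^esub>x\<in>{x. \<phi> x \<noteq> \<zero>\<^bsub>R\<^esub>}. m x \<star>\<^bsub>M\<^esub> \<phi> x)"

lemma free_rmodule_right_module:
  fixes R :: "('a, 'r) ring_scheme"
  assumes "ring R" shows "right_module R (free_rmodule R X)"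
proof -
  interpret R: ring R by fact
  let ?F = "free_rmodule R X"
  have add_cl: "\<phi> \<oplus>\<^bsub>?F\<^esub> \<psi> \<in> carrier ?F" if "\<phi> \<in> carrier ?F" "\<psi> \<in> carrier ?F" for \<phi> \<psi>
  proof -
    have "{x. \<phi> x \<oplus>\<^bsub>R\<^esub> \<psi> x \<noteq> \<zero>\<^bsub>R\<^esub>} \<subseteq> {x. \<phi> x \<noteq> \<zero>\<^bsub>R\<^esub>} \<union> {x. \<psi> x \<noteq> \<zero>\<^bsub>R\<^esub>}"
      by auto
    with that show ?thesis
      by (auto simp: free_rmodule_def intro: finite_subset)
  qed
  have neg_cl: "(\<lambda>x. \<ominus>\<^bsub>R\<^esub> \<phi> x) \<in> carrier ?F" if "\<phi> \<in> carrier ?F" for \<phi>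
  proof -
    have "{x. \<ominus>\<^bsub>R\<^esub> \<phi> x \<noteq> \<zero>\<^bsub>R\<^esub>} \<subseteq> {x. \<phi> x \<noteq> \<zero>\<^bsub>R\<^esub>}" by auto
    with that show ?thesis
      by (auto simp: free_rmodule_def intro: finite_subset)
  qed
  have smult_cl: "\<phi> \<star>\<^bsub>?F\<^esub> a \<in> carrier ?F" if "\<phi> \<in> carrier ?F" "a \<in> carrier R" for \<phi> a
  proof -
    have "{x. \<phi> x \<otimes>\<^bsub>R\<^esub> a \<noteq> \<zero>\<^bsub>R\<^esub>} \<subseteq> {x. \<phi> x \<noteq> \<zero>\<^bsub>R\<^esub>}" using that by auto
    with that show ?thesis
      by (auto simp: free_rmodule_def intro: finite_subset)
  qed
  have "abelian_group ?F"
  proof (rule abelian_groupI)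
    fix \<phi> assume \<phi>: "\<phi> \<in> carrier ?F"
    show "\<exists>\<psi>\<in>carrier ?F. \<psi> \<oplus>\<^bsub>?F\<^esub> \<phi> = \<zero>\<^bsub>?F\<^esub>"
      using \<phi> neg_cl[OF \<phi>]
      by (intro bexI[of _ "\<lambda>x. \<ominus>\<^bsub>R\<^esub> \<phi> x"]) (auto simp: free_rmodule_def R.l_neg)
  qed (use add_cl in \<open>auto simp: free_rmodule_def R.a_assoc R.a_comm R.a_lcomm\<close>)
  then show ?thesis
    by (intro right_module.intro right_module_axioms.intro)
       (use R.ring_axioms smult_cl in
         \<open>auto simp: free_rmodule_def R.l_distr R.r_distr R.m_assoc\<close>)
qed

lemma free_eval_superset:
  assumes M: "right_module R M" and A: "finite A" "{x. \<phi> x \<noteq> \<zero>\<^bsub>R\<^esub>} \<subseteq> A"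
    and \<phi>: "\<And>x. \<phi> x \<in> carrier R" and m: "\<And>x. x \<in> A \<Longrightarrow> m x \<in> carrier M"
  shows "free_eval R M m \<phi> = (\<Oplus>\<^bsub>M\<^esub>x\<in>A. m x \<star>\<^bsub>M\<^esub> \<phi> x)"
proof -
  interpret right_module R M by fact
  show ?thesis unfolding free_eval_def
    by (rule M.add.finprod_mono_neutral_cong_left) (use A \<phi> m in auto)
qed

lemma free_eval_hom:
  fixes R :: "('a, 'r) ring_scheme" and M :: "('a, 'c, 'm) rmodule_scheme"
  assumes M: "right_module R M" and m: "\<And>x. x \<in> X \<Longrightarrow> m x \<in> carrier M"
  shows "free_eval R M m \<in> rmod_hom R (free_rmodule R X) M"
proof -
  interpret right_module R M by fact
  have F: "right_module R (free_rmodule R X)"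
    using R.ring_axioms by (rule free_rmodule_right_module)
  interpret F: right_module R "free_rmodule R X" by (rule F)
  have car: "(\<forall>x. \<phi> x \<in> carrier R) \<and> finite {x. \<phi> x \<noteq> \<zero>\<^bsub>R\<^esub>} \<and> {x. \<phi> x \<noteq> \<zero>\<^bsub>R\<^esub>} \<subseteq> X"
    if "\<phi> \<in> carrier (free_rmodule R X)" for \<phi>
    using that by (simp add: free_rmodule_def)
  show ?thesis
  proof (rule rmod_homI)
    fix \<phi> assume \<phi>: "\<phi> \<in> carrier (free_rmodule R X)"
    show "free_eval R M m \<phi> \<in> carrier M"
      unfolding free_eval_def by (rule M.finsum_closed) (use car[OF \<phi>] m in auto)
  next
    fix \<phi> \<psi> assume \<phi>: "\<phi> \<in> carrier (free_rmodule R X)" and \<psi>: "\<psi> \<in> carrier (free_rmodule R X)"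
    define A where "A = {x. \<phi> x \<noteq> \<zero>\<^bsub>R\<^esub>} \<union> {x. \<psi> x \<noteq> \<zero>\<^bsub>R\<^esub>}"
    have A: "finite A" "\<And>x. x \<in> A \<Longrightarrow> m x \<in> carrier M"
      using car[OF \<phi>] car[OF \<psi>] m by (auto simp: A_def)
    have cl: "\<And>x. \<phi> x \<in> carrier R" "\<And>x. \<psi> x \<in> carrier R"
      using car[OF \<phi>] car[OF \<psi>] by auto
    have s: "\<phi> \<oplus>\<^bsub>free_rmodule R X\<^esub> \<psi> = (\<lambda>x. \<phi> x \<oplus>\<^bsub>R\<^esub> \<psi> x)"
      by (simp add: free_rmodule_def)
    have "free_eval R M m (\<lambda>x. \<phi> x \<oplus>\<^bsub>R\<^esub> \<psi> x) = (\<Oplus>\<^bsub>M\<^esub>x\<in>A. m x \<star>\<^bsub>M\<^esub> (\<phi> x \<oplus>\<^bsub>R\<^esub> \<psi> x))"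
      by (rule free_eval_superset[OF M]) (use A cl in \<open>auto simp: A_def\<close>)
    also have "\<dots> = (\<Oplus>\<^bsub>M\<^esub>x\<in>A. m x \<star>\<^bsub>M\<^esub> \<phi> x \<oplus>\<^bsub>M\<^esub> m x \<star>\<^bsub>M\<^esub> \<psi> x)"
      by (rule M.finsum_cong') (use A cl in \<open>auto simp: rsmult_r_distr\<close>)
    also have "\<dots> = (\<Oplus>\<^bsub>M\<^esub>x\<in>A. m x \<star>\<^bsub>M\<^esub> \<phi> x) \<oplus>\<^bsub>M\<^esub> (\<Oplus>\<^bsub>M\<^esub>x\<in>A. m x \<star>\<^bsub>M\<^esub> \<psi> x)"
      by (rule M.finsum_addf) (use A cl in auto)
    also have "(\<Oplus>\<^bsub>M\<^esub>x\<in>A. m x \<star>\<^bsub>M\<^esub> \<phi> x) = free_eval R M m \<phi>"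
      by (rule free_eval_superset[OF M, symmetric]) (use A cl in \<open>auto simp: A_def\<close>)
    also have "(\<Oplus>\<^bsub>M\<^esub>x\<in>A. m x \<star>\<^bsub>M\<^esub> \<psi> x) = free_eval R M m \<psi>"
      by (rule free_eval_superset[OF M, symmetric]) (use A cl in \<open>auto simp: A_def\<close>)
    finally show "free_eval R M m (\<phi> \<oplus>\<^bsub>free_rmodule R X\<^esub> \<psi>)
        = free_eval R M m \<phi> \<oplus>\<^bsub>M\<^esub> free_eval R M m \<psi>"
      by (simp add: s)
  next
    fix \<phi> a assume \<phi>: "\<phi> \<in> carrier (free_rmodule R X)" and a: "a \<in> carrier R"
    define A where "A = {x. \<phi> x \<noteq> \<zero>\<^bsub>R\<^esub>}"
    have A: "finite A" "\<And>x. x \<in> A \<Longrightarrow> m x \<in> carrier M" and cl: "\<And>x. \<phi> x \<in> carrier R"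
      using car[OF \<phi>] m by (auto simp: A_def)
    have "free_eval R M m (\<lambda>x. \<phi> x \<otimes>\<^bsub>R\<^esub> a) = (\<Oplus>\<^bsub>M\<^esub>x\<in>A. m x \<star>\<^bsub>M\<^esub> (\<phi> x \<otimes>\<^bsub>R\<^esub> a))"
      by (rule free_eval_superset[OF M]) (use A cl a in \<open>auto simp: A_def\<close>)
    also have "\<dots> = (\<Oplus>\<^bsub>M\<^esub>x\<in>A. (m x \<star>\<^bsub>M\<^esub> \<phi> x) \<star>\<^bsub>M\<^esub> a)"
      by (rule M.finsum_cong') (use A cl a in \<open>auto simp: rsmult_assoc\<close>)
    also have "\<dots> = (\<Oplus>\<^bsub>M\<^esub>x\<in>A. m x \<star>\<^bsub>M\<^esub> \<phi> x) \<star>\<^bsub>M\<^esub> a"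
      by (rule finsum_rsmult[symmetric]) (use A cl a in auto)
    finally show "free_eval R M m (\<phi> \<star>\<^bsub>free_rmodule R X\<^esub> a) = free_eval R M m \<phi> \<star>\<^bsub>M\<^esub> a"
      by (simp add: free_rmodule_def free_eval_def A_def)
  qed
qed

lemma hom_free_eval:
  assumes M: "right_module R M" and N: "right_module R N" and g: "g \<in> rmod_hom R M N"
    and m: "\<And>x. x \<in> X \<Longrightarrow> m x \<in> carrier M" and \<phi>: "\<phi> \<in> carrier (free_rmodule R X)"
  shows "g (free_eval R M m \<phi>) = free_eval R N (\<lambda>x. g (m x)) \<phi>"
proof -
  interpret M: right_module R M by fact
  interpret N: right_module R N by fact
  have g0: "g \<zero>\<^bsub>M\<^esub> = \<zero>\<^bsub>N\<^esub>"
    using rmod_homD[OF g] M.zero_closed M.rsmult_zero_right N.rsmult_zero_right M.R.zero_closed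
    by metis
  have "g (\<Oplus>\<^bsub>M\<^esub>x\<in>A. m x \<star>\<^bsub>M\<^esub> \<phi> x) = (\<Oplus>\<^bsub>N\<^esub>x\<in>A. g (m x) \<star>\<^bsub>N\<^esub> \<phi> x)"
    if "finite A" "A \<subseteq> X" for A
    using that
  proof (induction A rule: finite_induct)
    case empty
    then show ?case by (simp add: g0)
  next
    case (insert x F)
    have c: "\<And>x. \<phi> x \<in> carrier R" using \<phi> by (simp add: free_rmodule_def)
    have 1: "(\<lambda>x. m x \<star>\<^bsub>M\<^esub> \<phi> x) \<in> F \<rightarrow> carrier M" "m x \<star>\<^bsub>M\<^esub> \<phi> x \<in> carrier M"
      using insert.prems m c by auto
    have 2: "(\<lambda>x. g (m x) \<star>\<^bsub>N\<^esub> \<phi> x) \<in> F \<rightarrow> carrier N" "g (m x) \<star>\<^bsub>N\<^esub> \<phi> x \<in> carrier N"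
      using insert.prems m c rmod_homD(1)[OF g] by auto
    show ?case
      using insert 1 2 m c rmod_homD(2,3)[OF g]
      by (simp add: M.finsum_closed)
  qed
  then show ?thesis
    using \<phi> by (simp add: free_eval_def free_rmodule_def)
qed

lemma projective_rmodule_lift:
  fixes R :: "('a, 'r) ring_scheme" and P :: "('a, 'b) rmodule"
    and M :: "('a, 'c, 'm) rmodule_scheme" and N :: "('a, 'd, 'n) rmodule_scheme"
  assumes P: "projective_rmodule R P" and M: "right_module R M" and N: "right_module R N"
    and g: "g \<in> rmod_hom R M N" and surj: "g ` carrier M = carrier N"
    and f: "f \<in> rmod_hom R P N"
  obtains h where "h \<in> rmod_hom R P M" "\<And>x. x \<in> carrier P \<Longrightarrow> g (h x) = f x"
proof -
  have P': "right_module R P" using P by (simp add: projective_rmodule_def)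
  interpret P: right_module R P by (rule P')
  let ?F = "free_rmodule R (carrier P)" and ?e = "free_eval R P (\<lambda>x. x)"
  have F: "right_module R ?F" using P.R.ring_axioms by (rule free_rmodule_right_module)
  have e: "?e \<in> rmod_hom R ?F P" by (rule free_eval_hom[OF P']) simp
  have "x \<in> ?e ` carrier ?F" if x: "x \<in> carrier P" for x
  proof -
    define \<delta> where "\<delta> = (\<lambda>y. if y = x then \<one>\<^bsub>R\<^esub> else \<zero>\<^bsub>R\<^esub>)"
    have supp: "{y. \<delta> y \<noteq> \<zero>\<^bsub>R\<^esub>} \<subseteq> {x}" by (auto simp: \<delta>_def)
    have "\<delta> \<in> carrier ?F"
      using x supp finite_subset[OF supp] by (auto simp: free_rmodule_def \<delta>_def)
    moreover have "?e \<delta> = (\<Oplus>\<^bsub>P\<^esub>y\<in>{x}. y \<star>\<^bsub>P\<^esub> \<delta> y)"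
      by (rule free_eval_superset[OF P']) (use supp x in \<open>auto simp: \<delta>_def\<close>)
    then have "?e \<delta> = x" using x by (simp add: \<delta>_def)
    ultimately show ?thesis by (metis imageI)
  qed
  then have "?e ` carrier ?F = carrier P" using rmod_homD(1)[OF e] by blast
  moreover have "(\<lambda>x. x) \<in> rmod_hom R P P" by (rule rmod_homI) auto
  ultimately obtain s where s: "s \<in> rmod_hom R P ?F" "\<And>x. x \<in> carrier P \<Longrightarrow> ?e (s x) = x"
    using P F P' e unfolding projective_rmodule_def by metis
  define m where "m = (\<lambda>x. SOME y. y \<in> carrier M \<and> g y = f x)"
  have m: "m x \<in> carrier M" "g (m x) = f x" if "x \<in> carrier P" for x
  proof -
    have "\<exists>y. y \<in> carrier M \<and> g y = f x"
      using surj rmod_homD(1)[OF f that] by (metis imageE)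
    from someI_ex[OF this] show "m x \<in> carrier M" "g (m x) = f x" by (auto simp: m_def)
  qed
  have k: "free_eval R M m \<in> rmod_hom R ?F M"
    by (rule free_eval_hom[OF M m(1)])
  define h where "h = (\<lambda>x. free_eval R M m (s x))"
  have "h \<in> rmod_hom R P M"
    unfolding h_def using rmod_homD[OF k] rmod_homD[OF s(1)] by (intro rmod_homI) simp_all
  moreover have "g (h x) = f x" if x: "x \<in> carrier P" for x
  proof -
    have sx: "s x \<in> carrier ?F" using rmod_homD(1)[OF s(1) x] .
    have "g (h x) = free_eval R N (\<lambda>y. g (m y)) (s x)"
      unfolding h_def by (rule hom_free_eval[OF M N g m(1) sx])
    also have "\<dots> = free_eval R N f (s x)"
    proof -
      interpret N: right_module R N by fact
      show ?thesis unfolding free_eval_def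
        by (rule N.M.finsum_cong')
           (use sx m(2) rmod_homD(1)[OF f] in \<open>auto simp: free_rmodule_def subset_iff\<close>)
    qed
    also have "\<dots> = f (?e (s x))"
      by (rule hom_free_eval[OF P' N f _ sx, symmetric]) simp
    finally show ?thesis using s(2)[OF x] by simp
  qed
  ultimately show ?thesis by (rule that)
qed

end

theory Submission
  imports Defs
begin

text \<open>
  Write \<open>P'\<close> as the image of an idempotent on a free \<open>R/I\<close>-module of countable rank and lift this
  idempotent to an endomorphism \<open>A\<close> of the free \<open>R\<close>-module \<open>F\<close>. Then \<open>A\<^sup>2 - A\<close> has entries in
  \<open>I = Tr(Q)\<close>, so it factors as \<open>v u\<close> through a direct sum \<open>W\<close> of copies of \<open>Q\<close>. The module \<open>P\<close> is
  \<open>W\<close> plus the colimit of the maps \<open>f\<^sub>k(x, w) = (A x, w, u x)\<close> from \<open>F \<oplus> W\<^sup>k\<close> to \<open>F \<oplus> W\<^sup>k \<oplus> W\<close>. With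
  \<open>g\<^sub>k(y, w, w', w'') = (y - v w', w, w')\<close> one has \<open>g\<^sub>k f\<^sub>k\<^sub>+\<^sub>1 f\<^sub>k = f\<^sub>k\<close>, which makes the colimit
  projective. Since \<open>W = W I\<close>, reduction modulo \<open>I\<close> kills every \<open>W\<close> and leaves the colimit of the
  lifted idempotent, which is \<open>P'\<close>. The extra summand \<open>W\<close> ensures \<open>I \<subseteq> Tr(P)\<close>; the equality of
  traces then follows by pushing functionals on \<open>P\<close> down to \<open>P/PI\<close> and lifting functionals on \<open>P'\<close>
  by projectivity.

  The splitting is explicit: the colimit is the cokernel of a map \<open>j\<close> which has a left inverse \<open>r\<close>,
  so \<open>P\<close> is the image of the idempotent \<open>\<kappa> - j r\<close> for a suitable projection \<open>\<kappa>\<close>.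
\<close>

section \<open>Finite sums and homomorphisms\<close>

lemma finite_sums_zero:
  "abelian_monoid G \<Longrightarrow> \<zero>\<^bsub>G\<^esub> \<in> finite_sums G X"
  unfolding finite_sums_def
  by (auto intro!: exI[of _ "0::nat"] simp: abelian_monoid.finsum_empty)

lemma finite_sums_incl:
  assumes "abelian_monoid G" "X \<subseteq> carrier G" "x \<in> X"
  shows "x \<in> finite_sums G X"
proof -
  interpret abelian_monoid G by fact
  have "x = (\<Oplus>\<^bsub>G\<^esub>i\<in>{..<Suc 0}. (\<lambda>_. x) i)"
    using assms by (auto simp: lessThan_Suc)
  then show ?thesis
    unfolding finite_sums_def using assms(3) by blast
qed

lemma finite_sums_add:
  assumes "abelian_monoid G" "X \<subseteq> carrier G" "a \<in> finite_sums G X" "b \<in> finite_sums G X"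
  shows "a \<oplus>\<^bsub>G\<^esub> b \<in> finite_sums G X"
proof -
  interpret abelian_monoid G by fact
  obtain n x where x: "x \<in> {..<n::nat} \<rightarrow> X" "a = (\<Oplus>\<^bsub>G\<^esub>i\<in>{..<n}. x i)"
    using assms(3) unfolding finite_sums_def by blast
  obtain m y where y: "y \<in> {..<m::nat} \<rightarrow> X" "b = (\<Oplus>\<^bsub>G\<^esub>i\<in>{..<m}. y i)"
    using assms(4) unfolding finite_sums_def by blast
  define z where "z i = (if i < n then x i else y (i - n))" for i
  have z: "z i \<in> X" if "i < n + m" for i
    using that x(1) y(1) by (auto simp: z_def Pi_iff)
  have *: "(\<Oplus>\<^bsub>G\<^esub>i\<in>{..<n + k}. z i) = a \<oplus>\<^bsub>G\<^esub> (\<Oplus>\<^bsub>G\<^esub>i\<in>{..<k}. y i)" if "k \<le> m" for k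
    using that
  proof (induction k)
    case 0
    have "(\<Oplus>\<^bsub>G\<^esub>i\<in>{..<n}. z i) = a"
      unfolding x(2) by (rule finsum_cong') (use x(1) assms(2) in \<open>auto simp: z_def\<close>)
    moreover have "a \<in> carrier G"
      unfolding x(2) by (rule finsum_closed) (use x(1) assms(2) in auto)
    ultimately show ?case by simp
  next
    case (Suc k)
    have cl: "a \<in> carrier G" "\<And>i. i < m \<Longrightarrow> y i \<in> carrier G" "\<And>i. i < n + m \<Longrightarrow> z i \<in> carrier G"
      unfolding x(2) using x(1) y(1) z assms(2) by (auto intro!: finsum_closed)
    have 1: "(\<Oplus>\<^bsub>G\<^esub>i\<in>{..<Suc (n + k)}. z i) = z (n + k) \<oplus>\<^bsub>G\<^esub> (\<Oplus>\<^bsub>G\<^esub>i\<in>{..<n + k}. z i)"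
      using cl Suc.prems by (subst lessThan_Suc, subst finsum_insert) auto
    have 2: "(\<Oplus>\<^bsub>G\<^esub>i\<in>{..<Suc k}. y i) = y k \<oplus>\<^bsub>G\<^esub> (\<Oplus>\<^bsub>G\<^esub>i\<in>{..<k}. y i)"
      using cl Suc.prems by (subst lessThan_Suc, subst finsum_insert) auto
    have 3: "(\<Oplus>\<^bsub>G\<^esub>i\<in>{..<k}. y i) \<in> carrier G"
      using cl Suc.prems by (auto intro!: finsum_closed)
    have "z (n + k) = y k" by (simp add: z_def)
    then show ?case
      using Suc cl 1 2 3 by (simp add: a_lcomm)
  qed
  have "a \<oplus>\<^bsub>G\<^esub> b = (\<Oplus>\<^bsub>G\<^esub>i\<in>{..<n + m}. z i)"
    using *[of m] y(2) by simp
  then show ?thesis unfolding finite_sums_def using z by blast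
qed

lemma finite_sums_induct [consumes 2, case_names mem zero add]:
  assumes "x \<in> finite_sums G X" "abelian_monoid G"
    and mem: "\<And>x. x \<in> X \<Longrightarrow> x \<in> carrier G \<and> P x"
    and zero: "P \<zero>\<^bsub>G\<^esub>"
    and add: "\<And>x y. x \<in> carrier G \<Longrightarrow> y \<in> carrier G \<Longrightarrow> P x \<Longrightarrow> P y \<Longrightarrow> P (x \<oplus>\<^bsub>G\<^esub> y)"
  shows "P x"
proof -
  interpret abelian_monoid G by fact
  obtain n y where y: "y \<in> {..<n::nat} \<rightarrow> X" "x = (\<Oplus>\<^bsub>G\<^esub>i\<in>{..<n}. y i)"
    using assms(1) unfolding finite_sums_def by blast
  have "P (\<Oplus>\<^bsub>G\<^esub>i\<in>{..<k}. y i)" if "k \<le> n" for k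
    using that
  proof (induction k)
    case 0 then show ?case by (simp add: zero)
  next
    case (Suc k)
    have cl: "\<And>i. i < n \<Longrightarrow> y i \<in> carrier G \<and> P (y i)" using y mem by auto
    have "(\<Oplus>\<^bsub>G\<^esub>i\<in>{..<Suc k}. y i) = y k \<oplus>\<^bsub>G\<^esub> (\<Oplus>\<^bsub>G\<^esub>i\<in>{..<k}. y i)"
      using cl Suc.prems by (subst lessThan_Suc, subst finsum_insert) auto
    then show ?case using Suc cl by (auto intro!: add finsum_closed)
  qed
  then show ?thesis using y(2) by simp
qed

lemma finite_sums_carrier:
  "abelian_monoid G \<Longrightarrow> X \<subseteq> carrier G \<Longrightarrow> finite_sums G X \<subseteq> carrier G"
  unfolding finite_sums_def by (auto intro!: abelian_monoid.finsum_closed)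

lemma (in abelian_monoid) finsum_in:
  assumes "finite A" "\<zero> \<in> S" "S \<subseteq> carrier G" "\<And>x y. x \<in> S \<Longrightarrow> y \<in> S \<Longrightarrow> x \<oplus> y \<in> S"
    "\<And>i. i \<in> A \<Longrightarrow> f i \<in> S"
  shows "(\<Oplus>i\<in>A. f i) \<in> S"
  using assms(1,5)
proof (induction A rule: finite_induct)
  case empty then show ?case by (simp add: assms)
next
  case (insert x F)
  then have "f \<in> F \<rightarrow> carrier G" "f x \<in> carrier G" using assms(3) by auto
  then show ?case using insert assms(4) by simp
qed

lemma right_module_abelian_monoid: "right_module R M \<Longrightarrow> abelian_monoid M"
  by (simp add: right_module_def abelian_group_def)

lemma regular_right_module:
  fixes R :: "('a, 'r) ring_scheme"
  assumes "ring R" shows "right_module R (regular_rmodule R)"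
proof -
  interpret R: ring R by fact
  have "abelian_group (regular_rmodule R)"
    by (rule abelian_groupI)
       (auto simp: regular_rmodule_def R.a_assoc R.a_comm R.a_lcomm intro: R.l_neg bexI[of _ "\<ominus>\<^bsub>R\<^esub> x" for x])
  then show ?thesis
    by (intro right_module.intro right_module_axioms.intro)
       (use assms in \<open>auto simp: regular_rmodule_def R.l_distr R.r_distr R.m_assoc\<close>)
qed

lemma rmod_hom_id: "(\<lambda>x. x) \<in> rmod_hom R M M"
  by (simp add: rmod_hom_def)

lemma rmod_hom_comp:
  "f \<in> rmod_hom R M N \<Longrightarrow> g \<in> rmod_hom R N L \<Longrightarrow> (\<lambda>x. g (f x)) \<in> rmod_hom R M L"
  by (auto simp: rmod_hom_def Pi_iff)

lemma rmod_hom_zero_map: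
  "right_module R N \<Longrightarrow> (\<lambda>_. \<zero>\<^bsub>N\<^esub>) \<in> rmod_hom R M N"
  by (rule rmod_homI)
    (simp_all add: right_module.rsmult_zero_left right_module_abelian_monoid
       abelian_monoid.zero_closed abelian_monoid.l_zero)

lemma rmod_hom_add:
  assumes N: "right_module R N" and f: "f \<in> rmod_hom R M N" and g: "g \<in> rmod_hom R M N"
  shows "(\<lambda>x. f x \<oplus>\<^bsub>N\<^esub> g x) \<in> rmod_hom R M N"
proof -
  interpret N: right_module R N by fact
  show ?thesis
    using rmod_homD[OF f] rmod_homD[OF g]
    by (intro rmod_homI) (simp_all add: N.rsmult_l_distr N.M.a_ac)
qed

lemma (in right_module) rsmult_minus_left:
  assumes "x \<in> carrier M" "a \<in> carrier R"
  shows "(\<ominus>\<^bsub>M\<^esub> x) \<star>\<^bsub>M\<^esub> a = \<ominus>\<^bsub>M\<^esub> (x \<star>\<^bsub>M\<^esub> a)"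
proof (rule M.minus_equality[symmetric])
  show "(\<ominus>\<^bsub>M\<^esub> x) \<star>\<^bsub>M\<^esub> a \<oplus>\<^bsub>M\<^esub> x \<star>\<^bsub>M\<^esub> a = \<zero>\<^bsub>M\<^esub>"
    using assms rsmult_l_distr[of "\<ominus>\<^bsub>M\<^esub> x" x a] by (simp add: M.l_neg)
qed (use assms in auto)

lemma (in right_module) rsmult_minus_right:
  assumes "x \<in> carrier M" "a \<in> carrier R"
  shows "x \<star>\<^bsub>M\<^esub> (\<ominus>\<^bsub>R\<^esub> a) = \<ominus>\<^bsub>M\<^esub> (x \<star>\<^bsub>M\<^esub> a)"
proof (rule M.minus_equality[symmetric])
  show "x \<star>\<^bsub>M\<^esub> (\<ominus>\<^bsub>R\<^esub> a) \<oplus>\<^bsub>M\<^esub> x \<star>\<^bsub>M\<^esub> a = \<zero>\<^bsub>M\<^esub>"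
    using assms rsmult_r_distr[of x "\<ominus>\<^bsub>R\<^esub> a" a] by (simp add: R.l_neg)
qed (use assms in auto)

lemma rmod_hom_zero:
  assumes "right_module R M" "right_module R N" "f \<in> rmod_hom R M N"
  shows "f \<zero>\<^bsub>M\<^esub> = \<zero>\<^bsub>N\<^esub>"
proof -
  interpret M: right_module R M by fact
  interpret N: right_module R N by fact
  show ?thesis
    using rmod_homD[OF assms(3)] M.zero_closed M.rsmult_zero_right N.rsmult_zero_right
      M.R.zero_closed by metis
qed

lemma rmod_hom_uminus:
  assumes M: "right_module R M" and N: "right_module R N" and f: "f \<in> rmod_hom R M N"
    and x: "x \<in> carrier M"
  shows "f (\<ominus>\<^bsub>M\<^esub> x) = \<ominus>\<^bsub>N\<^esub> f x"
proof -
  interpret M: right_module R M by fact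
  interpret N: right_module R N by fact
  show ?thesis
  proof (rule N.M.minus_equality[symmetric])
    show "f (\<ominus>\<^bsub>M\<^esub> x) \<oplus>\<^bsub>N\<^esub> f x = \<zero>\<^bsub>N\<^esub>"
      using x rmod_homD(2)[OF f, of "\<ominus>\<^bsub>M\<^esub> x" x] rmod_hom_zero[OF M N f] by (simp add: M.M.l_neg)
  qed (use x rmod_homD(1)[OF f] in auto)
qed

lemma rmod_hom_minus_apply:
  assumes M: "right_module R M" and N: "right_module R N" and f: "f \<in> rmod_hom R M N"
    and x: "x \<in> carrier M" "y \<in> carrier M"
  shows "f (x \<ominus>\<^bsub>M\<^esub> y) = f x \<ominus>\<^bsub>N\<^esub> f y"
proof -
  interpret M: right_module R M by fact
  interpret N: right_module R N by fact
  show ?thesis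
    using x rmod_homD[OF f] rmod_hom_uminus[OF M N f]
    by (simp add: M.M.minus_eq N.M.minus_eq)
qed

lemma rmod_hom_minus:
  assumes N: "right_module R N" and f: "f \<in> rmod_hom R M N" and g: "g \<in> rmod_hom R M N"
  shows "(\<lambda>x. f x \<ominus>\<^bsub>N\<^esub> g x) \<in> rmod_hom R M N"
proof -
  interpret N: right_module R N by fact
  show ?thesis
    using rmod_homD[OF f] rmod_homD[OF g]
    by (intro rmod_homI)
      (simp_all add: N.rsmult_l_distr N.rsmult_minus_left N.M.a_ac N.M.minus_eq N.M.minus_add)
qed

lemma rmod_hom_finsum:
  assumes M: "right_module R M" and N: "right_module R N" and g: "g \<in> rmod_hom R M N"
    and "finite A" "\<And>i. i \<in> A \<Longrightarrow> f i \<in> carrier M"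
  shows "g (\<Oplus>\<^bsub>M\<^esub>i\<in>A. f i) = (\<Oplus>\<^bsub>N\<^esub>i\<in>A. g (f i))"
proof -
  interpret M: right_module R M by fact
  interpret N: right_module R N by fact
  show ?thesis
    using assms(4,5)
  proof (induction A rule: finite_induct)
    case empty then show ?case by (simp add: rmod_hom_zero[OF M N g])
  next
    case (insert x F)
    then have "f \<in> F \<rightarrow> carrier M" "(\<lambda>i. g (f i)) \<in> F \<rightarrow> carrier N"
      using rmod_homD(1)[OF g] by auto
    with insert show ?case using rmod_homD[OF g] by simp
  qed
qed

section \<open>Free modules\<close>

definition free_basis :: "('a, 'r) ring_scheme \<Rightarrow> 'b \<Rightarrow> 'b \<Rightarrow> 'a" where
  "free_basis R x = (\<lambda>y. if y = x then \<one>\<^bsub>R\<^esub> else \<zero>\<^bsub>R\<^esub>)"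

lemma free_basis_closed:
  assumes "ring R" "x \<in> X" shows "free_basis R x \<in> carrier (free_rmodule R X)"
proof -
  interpret ring R by fact
  have "{y. free_basis R x y \<noteq> \<zero>\<^bsub>R\<^esub>} \<subseteq> {x}" by (auto simp: free_basis_def)
  moreover from finite_subset[OF this] have "finite {y. free_basis R x y \<noteq> \<zero>\<^bsub>R\<^esub>}" by simp
  ultimately show ?thesis
    using assms(2) by (auto simp: free_rmodule_def free_basis_def)
qed

lemma free_eval_basis:
  assumes M: "right_module R M" and m: "m x \<in> carrier M"
  shows "free_eval R M m (free_basis R x) = m x"
proof -
  interpret right_module R M by fact
  have "free_eval R M m (free_basis R x) = (\<Oplus>\<^bsub>M\<^esub>y\<in>{x}. m y \<star>\<^bsub>M\<^esub> free_basis R x y)"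
    by (rule free_eval_superset[OF M]) (use m in \<open>auto simp: free_basis_def\<close>)
  then show ?thesis using m by (simp add: free_basis_def)
qed

lemma free_coord_hom:
  "(\<lambda>\<phi>. \<phi> x) \<in> rmod_hom R (free_rmodule R X) (regular_rmodule R)"
  by (auto simp: rmod_hom_def free_rmodule_def regular_rmodule_def)

text \<open>Every coordinate is a homomorphism to \<open>R\<close>, so \<open>hom_free_eval\<close>
  moves it inside the evaluation, where only the term at \<open>y\<close> survives.\<close>

lemma free_eval_basis_id:
  assumes R: "ring R" and \<phi>: "\<phi> \<in> carrier (free_rmodule R X)"
  shows "free_eval R (free_rmodule R X) (free_basis R) \<phi> = \<phi>"
proof
  fix y
  interpret ring R by fact
  have M: "right_module R (regular_rmodule R)" using R by (rule regular_right_module)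
  interpret M: right_module R "regular_rmodule R" by (rule M)
  have c: "\<phi> x \<in> carrier R" "finite {x. \<phi> x \<noteq> \<zero>\<^bsub>R\<^esub>}" for x using \<phi> by (auto simp: free_rmodule_def)
  have "free_eval R (free_rmodule R X) (free_basis R) \<phi> y
      = free_eval R (regular_rmodule R) (\<lambda>x. free_basis R x y) \<phi>"
    by (rule hom_free_eval[OF free_rmodule_right_module[OF R] M free_coord_hom _ \<phi>])
      (rule free_basis_closed[OF R])
  \<comment> \<open>\<open>y\<close> may lie outside the support of \<open>\<phi>\<close>; the
    summation set is first enlarged by \<open>y\<close> and then cut down to
    \<open>{y}\<close>.\<close>
  also have "\<dots> = (\<Oplus>\<^bsub>regular_rmodule R\<^esub>x\<in>insert y {x. \<phi> x \<noteq> \<zero>\<^bsub>R\<^esub>}. free_basis R x y \<star>\<^bsub>regular_rmodule R\<^esub> \<phi> x)"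
    by (rule free_eval_superset[OF M]) (use c in \<open>auto simp: free_basis_def regular_rmodule_def\<close>)
  also have "\<dots> = (\<Oplus>\<^bsub>regular_rmodule R\<^esub>x\<in>{y}. free_basis R x y \<star>\<^bsub>regular_rmodule R\<^esub> \<phi> x)"
    by (rule M.M.add.finprod_mono_neutral_cong_right)
      (use c in \<open>auto simp: free_basis_def regular_rmodule_def\<close>)
  also have "\<dots> = free_basis R y y \<star>\<^bsub>regular_rmodule R\<^esub> \<phi> y"
  proof -
    have "free_basis R y y \<star>\<^bsub>regular_rmodule R\<^esub> \<phi> y \<in> carrier (regular_rmodule R)"
      using c by (simp add: free_basis_def regular_rmodule_def)
    then show ?thesis by simp
  qed
  also have "\<dots> = \<phi> y"
    using c by (simp add: free_basis_def regular_rmodule_def)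
  finally show "free_eval R (free_rmodule R X) (free_basis R) \<phi> y = \<phi> y" .
qed

lemma free_hom_eq_eval:
  assumes M: "right_module R M" and g: "g \<in> rmod_hom R (free_rmodule R X) M"
    and \<phi>: "\<phi> \<in> carrier (free_rmodule R X)"
  shows "g \<phi> = free_eval R M (\<lambda>x. g (free_basis R x)) \<phi>"
proof -
  have R: "ring R" using M by (simp add: right_module_def)
  show ?thesis
    using hom_free_eval[OF free_rmodule_right_module[OF R] M g, of X "free_basis R" \<phi>]
      free_basis_closed[OF R, of _ X] \<phi> free_eval_basis_id[OF R \<phi>] by metis
qed

lemma free_hom_ext:
  assumes M: "right_module R M" and g: "g \<in> rmod_hom R (free_rmodule R X) M"
    and h: "h \<in> rmod_hom R (free_rmodule R X) M"
    and eq: "\<And>x. x \<in> X \<Longrightarrow> g (free_basis R x) = h (free_basis R x)"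
    and \<phi>: "\<phi> \<in> carrier (free_rmodule R X)"
  shows "g \<phi> = h \<phi>"
proof -
  interpret M: right_module R M by fact
  have b: "x \<in> X \<Longrightarrow> free_basis R x \<in> carrier (free_rmodule R X)" for x
    by (rule free_basis_closed[OF M.R.ring_axioms])
  have "free_eval R M (\<lambda>x. g (free_basis R x)) \<phi> = free_eval R M (\<lambda>x. h (free_basis R x)) \<phi>"
    unfolding free_eval_def
    by (rule M.M.finsum_cong')
      (use \<phi> eq rmod_homD(1)[OF h b] in \<open>auto simp: free_rmodule_def\<close>)
  then show ?thesis
    using free_hom_eq_eval[OF M g \<phi>] free_hom_eq_eval[OF M h \<phi>] by simp
qed

text \<open>\<open>S\<close> is only an additive submonoid, for instance a set of finite sums, so
  hypothesis \<open>b\<close> concerns basis values already multiplied by the coefficients of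
  \<open>\<phi>\<close>.\<close>

lemma free_hom_in:
  assumes M: "right_module R M" and g: "g \<in> rmod_hom R (free_rmodule R X) M"
    and \<phi>: "\<phi> \<in> carrier (free_rmodule R X)"
    and S: "S \<subseteq> carrier M" "\<zero>\<^bsub>M\<^esub> \<in> S" "\<And>x y. x \<in> S \<Longrightarrow> y \<in> S \<Longrightarrow> x \<oplus>\<^bsub>M\<^esub> y \<in> S"
    and b: "\<And>x. x \<in> X \<Longrightarrow> g (free_basis R x) \<star>\<^bsub>M\<^esub> \<phi> x \<in> S"
  shows "g \<phi> \<in> S"
proof -
  interpret M: right_module R M by fact
  show ?thesis
    unfolding free_hom_eq_eval[OF M g \<phi>] free_eval_def
    by (rule M.M.finsum_in) (use \<phi> S b in \<open>auto simp: free_rmodule_def\<close>)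
qed

lemma free_lift:
  assumes M: "right_module R M" and N: "right_module R N" and g: "g \<in> rmod_hom R M N"
    and surj: "carrier N \<subseteq> g ` carrier M" and f: "f \<in> rmod_hom R (free_rmodule R X) N"
  obtains h where "h \<in> rmod_hom R (free_rmodule R X) M"
    "\<And>\<phi>. \<phi> \<in> carrier (free_rmodule R X) \<Longrightarrow> g (h \<phi>) = f \<phi>"
proof -
  have R: "ring R" using M by (simp add: right_module_def)
  have "\<exists>y. y \<in> carrier M \<and> g y = f (free_basis R x)" if "x \<in> X" for x
    using surj rmod_homD(1)[OF f free_basis_closed[OF R that]] by (metis subsetD imageE)
  then obtain m where m: "\<And>x. x \<in> X \<Longrightarrow> m x \<in> carrier M" "\<And>x. x \<in> X \<Longrightarrow> g (m x) = f (free_basis R x)"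
    by metis
  have h: "free_eval R M m \<in> rmod_hom R (free_rmodule R X) M"
    by (rule free_eval_hom[OF M m(1)])
  show ?thesis
  proof (rule that[OF h])
    fix \<phi> assume "\<phi> \<in> carrier (free_rmodule R X)"
    then show "g (free_eval R M m \<phi>) = f \<phi>"
      by (rule free_hom_ext[OF N rmod_hom_comp[OF h g] f, rotated])
        (simp add: free_eval_basis[OF M] m)
  qed
qed

text \<open>A sequence of generators gives a surjection from the free module of countable rank, and
  projectivity splits it.\<close>

lemma countably_generated_projective_retract:
  fixes R :: "('a, 'r) ring_scheme" and M :: "('a, 'b) rmodule"
  assumes P: "projective_rmodule R M" and cg: "countably_generated_rmodule R M"
  obtains s t where "s \<in> rmod_hom R M (free_rmodule R (UNIV :: nat set))"
    "t \<in> rmod_hom R (free_rmodule R (UNIV :: nat set)) M"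
    "\<And>x. x \<in> carrier M \<Longrightarrow> t (s x) = x"
proof -
  have M: "right_module R M" using P by (simp add: projective_rmodule_def)
  interpret M: right_module R M by (rule M)
  let ?F = "free_rmodule R (UNIV :: nat set)"
  have F: "right_module R ?F" by (rule free_rmodule_right_module[OF M.R.ring_axioms])
  interpret F: right_module R ?F by (rule F)
  obtain X where X: "countable X" "X \<subseteq> carrier M"
    "carrier M = finite_sums M {x \<star>\<^bsub>M\<^esub> a | x a. x \<in> X \<and> a \<in> carrier R}"
    using cg unfolding countably_generated_rmodule_def by blast
  \<comment> \<open>Adjoining zero makes the generating set nonempty, so that a sequence enumerates
    it even when \<open>X\<close> is empty.\<close>
  define m where "m = from_nat_into (insert \<zero>\<^bsub>M\<^esub> X)"
  have rm: "range m = insert \<zero>\<^bsub>M\<^esub> X"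
    unfolding m_def using X(1) by (intro range_from_nat_into) auto
  have m: "m k \<in> carrier M" for k
    using rm X(2) by (metis M.M.zero_closed insertE rangeI subsetD)
  let ?e = "free_eval R M m"
  have e: "?e \<in> rmod_hom R ?F M" by (rule free_eval_hom[OF M m])
  have "x \<in> ?e ` carrier ?F" if "x \<in> carrier M" for x
    using that[unfolded X(3)] right_module_abelian_monoid[OF M]
  proof (induction rule: finite_sums_induct)
    case (mem x)
    then obtain y a where ya: "x = y \<star>\<^bsub>M\<^esub> a" "y \<in> X" "a \<in> carrier R" by blast
    obtain k where k: "y = m k" using ya(2) rm by blast
    have b: "free_basis R k \<in> carrier ?F" by (rule free_basis_closed[OF M.R.ring_axioms]) simp
    have "?e (free_basis R k \<star>\<^bsub>?F\<^esub> a) = x"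
      using rmod_homD(3)[OF e b ya(3)] free_eval_basis[OF M, of m k] m k ya by simp
    moreover have "free_basis R k \<star>\<^bsub>?F\<^esub> a \<in> carrier ?F" using b ya(3) by (rule F.rsmult_closed)
    moreover have "x \<in> carrier M" using X(2) ya by auto
    ultimately show ?case by blast
  next
    case zero
    then show ?case using rmod_hom_zero[OF F M e] F.M.zero_closed by (metis imageI)
  next
    case (add x y)
    then obtain \<phi> \<psi> where "x = ?e \<phi>" "y = ?e \<psi>" "\<phi> \<in> carrier ?F" "\<psi> \<in> carrier ?F" by blast
    then show ?case using rmod_homD(2)[OF e] F.M.a_closed by (metis imageI)
  qed
  then have "?e ` carrier ?F = carrier M" using rmod_homD(1)[OF e] by blast
  then show ?thesis
    using projective_rmodule_lift[OF P F M e _ rmod_hom_id] that e by metis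
qed

section \<open>Reduction modulo an ideal\<close>

text \<open>Along the projection of \<open>R\<close> onto \<open>R Quot I\<close> this makes an
  \<open>R Quot I\<close>-module an \<open>R\<close>-module, so that maps from
  \<open>R\<close>-modules into it can be \<open>R\<close>-linear.\<close>

definition restrict_scalars ::
    "['a \<Rightarrow> 'c, ('c, 'b, 'm) rmodule_scheme] \<Rightarrow> ('a, 'b) rmodule" where
  "restrict_scalars \<phi> M = \<lparr>carrier = carrier M, mult = mult M, one = \<one>\<^bsub>M\<^esub>,
     zero = \<zero>\<^bsub>M\<^esub>, add = add M, rsmult = (\<lambda>x a. x \<star>\<^bsub>M\<^esub> \<phi> a)\<rparr>"

lemma restrict_scalars_simps [simp]:
  "carrier (restrict_scalars \<phi> M) = carrier M"
  "\<zero>\<^bsub>restrict_scalars \<phi> M\<^esub> = \<zero>\<^bsub>M\<^esub>"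
  "x \<oplus>\<^bsub>restrict_scalars \<phi> M\<^esub> y = x \<oplus>\<^bsub>M\<^esub> y"
  "x \<star>\<^bsub>restrict_scalars \<phi> M\<^esub> a = x \<star>\<^bsub>M\<^esub> \<phi> a"
  by (simp_all add: restrict_scalars_def)

lemma restrict_scalars_right_module:
  fixes R :: "('a, 'r) ring_scheme" and S :: "('c, 's) ring_scheme"
    and M :: "('c, 'b, 'm) rmodule_scheme"
  assumes R: "ring R" and M: "right_module S M" and \<phi>: "\<phi> \<in> ring_hom R S"
  shows "right_module R (restrict_scalars \<phi> M)"
proof -
  interpret M: right_module S M by fact
  have "abelian_group (restrict_scalars \<phi> M)"
    by (rule abelian_groupI) (auto simp: M.M.a_ac intro!: M.M.l_neg bexI[of _ "\<ominus>\<^bsub>M\<^esub> x" for x])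
  then show ?thesis
    by (intro right_module.intro right_module_axioms.intro)
       (use R ring_hom_closed[OF \<phi>] ring_hom_add[OF \<phi>] ring_hom_mult[OF \<phi>] ring_hom_one[OF \<phi>] in
         \<open>auto simp: M.rsmult_l_distr M.rsmult_r_distr M.rsmult_assoc\<close>)
qed

lemma restrict_scalars_hom:
  "\<phi> \<in> ring_hom R S \<Longrightarrow> f \<in> rmod_hom S M N \<Longrightarrow>
    f \<in> rmod_hom R (restrict_scalars \<phi> M) (restrict_scalars \<phi> N)"
  by (auto simp: rmod_hom_def ring_hom_closed)

lemma rmod_ideal_prod_closed:
  assumes M: "right_module R M" and I: "ideal I R"
  shows "rmod_ideal_prod M I \<subseteq> carrier M"
    and "\<zero>\<^bsub>M\<^esub> \<in> rmod_ideal_prod M I"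
    and "x \<in> rmod_ideal_prod M I \<Longrightarrow> y \<in> rmod_ideal_prod M I \<Longrightarrow> x \<oplus>\<^bsub>M\<^esub> y \<in> rmod_ideal_prod M I"
    and "x \<in> carrier M \<Longrightarrow> a \<in> I \<Longrightarrow> x \<star>\<^bsub>M\<^esub> a \<in> rmod_ideal_prod M I"
    and "x \<in> rmod_ideal_prod M I \<Longrightarrow> b \<in> carrier R \<Longrightarrow> x \<star>\<^bsub>M\<^esub> b \<in> rmod_ideal_prod M I"
proof -
  interpret M: right_module R M by fact
  interpret I: ideal I R by fact
  let ?X = "{x \<star>\<^bsub>M\<^esub> a | x a. x \<in> carrier M \<and> a \<in> I}"
  have X: "?X \<subseteq> carrier M" using I.a_subset by auto
  note am = right_module_abelian_monoid[OF M]
  show 1: "rmod_ideal_prod M I \<subseteq> carrier M" "\<zero>\<^bsub>M\<^esub> \<in> rmod_ideal_prod M I"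
    unfolding rmod_ideal_prod_def
    by (rule finite_sums_carrier[OF am X], rule finite_sums_zero[OF am])
  show 2: "x \<oplus>\<^bsub>M\<^esub> y \<in> rmod_ideal_prod M I"
    if "x \<in> rmod_ideal_prod M I" "y \<in> rmod_ideal_prod M I" for x y
    using that unfolding rmod_ideal_prod_def by (rule finite_sums_add[OF am X])
  show 3: "x \<star>\<^bsub>M\<^esub> a \<in> rmod_ideal_prod M I" if "x \<in> carrier M" "a \<in> I" for x a
    unfolding rmod_ideal_prod_def by (rule finite_sums_incl[OF am X]) (use that in auto)
  show "x \<star>\<^bsub>M\<^esub> b \<in> rmod_ideal_prod M I"
    if "x \<in> rmod_ideal_prod M I" and b: "b \<in> carrier R"
    using that(1)[unfolded rmod_ideal_prod_def] am
  proof (induction rule: finite_sums_induct)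
    case (mem y)
    then obtain z a where za: "y = z \<star>\<^bsub>M\<^esub> a" "z \<in> carrier M" "a \<in> I" by blast
    moreover have "a \<in> carrier R" using za I.a_subset by auto
    ultimately show ?case
      using 3[of z "a \<otimes>\<^bsub>R\<^esub> b"] I.I_r_closed[of a b] b by (simp add: M.rsmult_assoc)
  next
    case zero
    then show ?case using 1 b by simp
  next
    case (add x y)
    then show ?case using 2 b by (simp add: M.rsmult_l_distr)
  qed
qed

lemma (in ideal) a_coset_eq_ideal_iff: "a \<in> carrier R \<Longrightarrow> I +> a = I \<longleftrightarrow> a \<in> I"
  using a_rcos_self a_rcos_const by metis

lemma (in ideal) FactRing_simps:
  "\<zero>\<^bsub>R Quot I\<^esub> = I" "carrier (R Quot I) = (\<lambda>t. I +> t) ` carrier R"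
  "a \<in> carrier R \<Longrightarrow> b \<in> carrier R \<Longrightarrow> (I +> a) \<oplus>\<^bsub>R Quot I\<^esub> (I +> b) = I +> (a \<oplus> b)"
  using a_rcos_sum by (auto simp: FactRing_def A_RCOSETS_defs a_r_coset_def)

section \<open>Surjections \<open>\<Phi>\<close> of \<open>P\<close> onto \<open>P'\<close> with
  kernel \<open>PI\<close>: quotient module and traces\<close>

context
  fixes R :: "('a, 'r) ring_scheme" and I :: "'a set"
    and P :: "('a, 'c) rmodule" and P' :: "('a set, 'b) rmodule" and \<Phi> :: "'c \<Rightarrow> 'b"
  assumes I: "ideal I R" and P: "right_module R P" and P': "right_module (R Quot I) P'"
    and \<Phi>: "\<Phi> \<in> rmod_hom R P (restrict_scalars (\<lambda>t. I +>\<^bsub>R\<^esub> t) P')"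
    and surj: "\<Phi> ` carrier P = carrier P'"
    and ker: "\<And>x. x \<in> carrier P \<Longrightarrow> \<Phi> x = \<zero>\<^bsub>P'\<^esub> \<Longrightarrow> x \<in> rmod_ideal_prod P I"
begin

interpretation I: ideal I R by (rule I)
interpretation P: right_module R P by (rule P)
interpretation P': right_module "R Quot I" P' by (rule P')

lemma restrict_quot_module: "right_module R (restrict_scalars (\<lambda>t. I +>\<^bsub>R\<^esub> t) P')"
  by (rule restrict_scalars_right_module[OF I.ring_axioms P' I.rcos_ring_hom])

lemma ideal_prod_kernel:
  "x \<in> rmod_ideal_prod P I \<longleftrightarrow> x \<in> carrier P \<and> \<Phi> x = \<zero>\<^bsub>P'\<^esub>"
proof
  assume x: "x \<in> rmod_ideal_prod P I"
  have "\<Phi> x = \<zero>\<^bsub>P'\<^esub>"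
    using x[unfolded rmod_ideal_prod_def] right_module_abelian_monoid[OF P]
  proof (induction rule: finite_sums_induct)
    case (mem y)
    then obtain z a where za: "y = z \<star>\<^bsub>P\<^esub> a" "z \<in> carrier P" "a \<in> I" by blast
    have a: "a \<in> carrier R" using za I.a_subset by auto
    have "I +>\<^bsub>R\<^esub> a = \<zero>\<^bsub>R Quot I\<^esub>" using za a I.a_coset_eq_ideal_iff by (simp add: I.FactRing_simps)
    moreover have "\<Phi> z \<in> carrier P'" using rmod_homD(1)[OF \<Phi> za(2)] by simp
    ultimately show ?case using za a rmod_homD(3)[OF \<Phi> za(2) a] by simp
  next
    case zero
    then show ?case using rmod_hom_zero[OF P restrict_quot_module \<Phi>] by simp
  next
    case (add x y)
    then show ?case using rmod_homD(2)[OF \<Phi>] by simp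
  qed
  then show "x \<in> carrier P \<and> \<Phi> x = \<zero>\<^bsub>P'\<^esub>" using x rmod_ideal_prod_closed(1)[OF P I] by auto
qed (use ker in auto)

lemma diff_in_ideal_prod:
  assumes "x \<in> carrier P" "y \<in> carrier P" "\<Phi> x = \<Phi> y"
  shows "x \<ominus>\<^bsub>P\<^esub> y \<in> rmod_ideal_prod P I"
proof -
  interpret P'': right_module R "restrict_scalars (\<lambda>t. I +>\<^bsub>R\<^esub> t) P'" by (rule restrict_quot_module)
  have "\<Phi> (x \<ominus>\<^bsub>P\<^esub> y) = \<zero>\<^bsub>P'\<^esub>"
    using rmod_hom_minus_apply[OF P restrict_quot_module \<Phi> assms(1,2)] assms
      P''.M.r_neg[of "\<Phi> y"] rmod_homD(1)[OF \<Phi> assms(2)] by (simp add: a_minus_def)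
  then show ?thesis using assms by (auto simp: ideal_prod_kernel)
qed

lemma coset_eq_fibre:
  assumes x: "x \<in> carrier P"
  shows "rmod_ideal_prod P I +>\<^bsub>P\<^esub> x = {y \<in> carrier P. \<Phi> y = \<Phi> x}"
proof
  show "rmod_ideal_prod P I +>\<^bsub>P\<^esub> x \<subseteq> {y \<in> carrier P. \<Phi> y = \<Phi> x}"
    using x rmod_homD(1,2)[OF \<Phi>] by (auto simp: a_r_coset_def' ideal_prod_kernel)
  show "{y \<in> carrier P. \<Phi> y = \<Phi> x} \<subseteq> rmod_ideal_prod P I +>\<^bsub>P\<^esub> x"
  proof safe
    fix y assume y: "y \<in> carrier P" "\<Phi> y = \<Phi> x"
    then have "y = (y \<ominus>\<^bsub>P\<^esub> x) \<oplus>\<^bsub>P\<^esub> x"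
      using x by (simp add: P.M.minus_eq P.M.a_assoc P.M.l_neg)
    then show "y \<in> rmod_ideal_prod P I +>\<^bsub>P\<^esub> x"
      using diff_in_ideal_prod[OF y(1) x y(2)] by (auto simp: a_r_coset_def')
  qed
qed

lemma quot_rmodule_iso: "rmod_iso (R Quot I) (quot_rmodule P I) P'"
proof -
  \<comment> \<open>The cosets of \<open>PI\<close> are the fibres of \<open>\<Phi>\<close>;
    \<open>fib\<close> and \<open>G\<close> are inverse bijections between values and
    fibres.\<close>
  define fib where "fib v = {y \<in> carrier P. \<Phi> y = v}" for v
  define G where "G X = the_elem (\<Phi> ` X)" for X
  let ?Q = "quot_rmodule P I"
  have ne: "\<exists>x\<in>carrier P. \<Phi> x = v" if "v \<in> carrier P'" for v using surj that by (metis imageE)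
  have G: "G (fib v) = v" if "v \<in> carrier P'" for v
  proof -
    have "\<Phi> ` fib v = {v}" using ne[OF that] by (auto simp: fib_def)
    then show ?thesis by (simp add: G_def)
  qed
  have \<Phi>c: "\<Phi> x \<in> carrier P'" if "x \<in> carrier P" for x using rmod_homD(1)[OF \<Phi> that] by simp
  have car: "carrier ?Q = fib ` carrier P'"
    using coset_eq_fibre surj
    by (auto simp: quot_rmodule_def Let_def A_RCOSETS_def' fib_def[abs_def])
  have add: "fib v \<oplus>\<^bsub>?Q\<^esub> fib w = fib (v \<oplus>\<^bsub>P'\<^esub> w)" if vw: "v \<in> carrier P'" "w \<in> carrier P'" for v w
  proof -
    obtain x y where xy: "x \<in> carrier P" "\<Phi> x = v" "y \<in> carrier P" "\<Phi> y = w" using ne vw by metis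
    \<comment> \<open>The element \<open>h\<close> of \<open>PI\<close> by which \<open>z\<close>
      differs from the sum of \<open>x\<close> and \<open>y\<close> is absorbed into the first
      summand, so the setwise sum of two fibres is a whole fibre.\<close>
    have "z \<in> fib v <+>\<^bsub>P\<^esub> fib w" if z: "z \<in> carrier P" "\<Phi> z = v \<oplus>\<^bsub>P'\<^esub> w" for z
    proof -
      have "\<Phi> (x \<oplus>\<^bsub>P\<^esub> y) = \<Phi> z" using rmod_homD(2)[OF \<Phi> xy(1,3)] xy z by simp
      then have "z \<in> rmod_ideal_prod P I +>\<^bsub>P\<^esub> (x \<oplus>\<^bsub>P\<^esub> y)"
        using z xy by (subst coset_eq_fibre) auto
      then obtain h where h: "h \<in> rmod_ideal_prod P I" "z = h \<oplus>\<^bsub>P\<^esub> (x \<oplus>\<^bsub>P\<^esub> y)"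
        by (auto simp: a_r_coset_def')
      have hc: "h \<in> carrier P" "\<Phi> h = \<zero>\<^bsub>P'\<^esub>" using h(1) by (auto simp: ideal_prod_kernel)
      have "z = (h \<oplus>\<^bsub>P\<^esub> x) \<oplus>\<^bsub>P\<^esub> y" using h hc xy by (simp add: P.M.a_assoc)
      moreover have "h \<oplus>\<^bsub>P\<^esub> x \<in> fib v"
        using hc xy rmod_homD(2)[OF \<Phi> hc(1) xy(1)] vw by (simp add: fib_def)
      ultimately show ?thesis using xy by (auto simp: set_add_def' fib_def)
    qed
    then show ?thesis
      using rmod_homD(2)[OF \<Phi>]
      by (auto simp: quot_rmodule_def Let_def set_add_def' fib_def)
  qed
  have smult: "fib v \<star>\<^bsub>?Q\<^esub> A = fib (v \<star>\<^bsub>P'\<^esub> A)" if v: "v \<in> carrier P'" and A: "A \<in> carrier (R Quot I)" for v A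
  proof -
    \<comment> \<open>The scalar action is a union over all representatives; each of them yields the
      same fibre.\<close>
    have cos: "rmod_ideal_prod P I +>\<^bsub>P\<^esub> (x \<star>\<^bsub>P\<^esub> a) = fib (v \<star>\<^bsub>P'\<^esub> A)" if "x \<in> fib v" "a \<in> A" for x a
    proof -
      obtain b where b: "b \<in> carrier R" "A = I +>\<^bsub>R\<^esub> b" using A by (auto simp: I.FactRing_simps)
      have a: "a \<in> carrier R" using that(2) b I.a_r_coset_subset_G I.a_subset by blast
      have "A = I +>\<^bsub>R\<^esub> a" using I.a_repr_independence[OF _ b(1) I.a_subgroup] that(2) b(2) by metis
      then show ?thesis
        using that(1) a rmod_homD(3)[OF \<Phi> _ a, of x]
        by (subst coset_eq_fibre) (auto simp: fib_def)
    qed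
    obtain x where "x \<in> fib v" using ne[OF v] by (auto simp: fib_def)
    moreover obtain a where "a \<in> A" using A I.a_rcos_self by (auto simp: I.FactRing_simps)
    ultimately show ?thesis
      using cos by (auto simp: quot_rmodule_def Let_def)
  qed
  have "G \<in> rmod_hom (R Quot I) ?Q P'"
    by (rule rmod_homI) (auto simp: car G add smult P'.M.a_closed)
  moreover have "bij_betw G (carrier ?Q) (carrier P')"
    by (rule bij_betw_byWitness[where f' = fib]) (auto simp: car G)
  ultimately show ?thesis unfolding rmod_iso_def by blast
qed

text \<open>A functional on \<open>P\<close> maps \<open>PI\<close> into \<open>I\<close>, hence
  induces a functional on \<open>P'\<close> with values in \<open>R Quot I\<close>.\<close>

lemma trace_quotient_subset:
  "(\<lambda>t. I +>\<^bsub>R\<^esub> t) ` trace_ideal R P \<subseteq> trace_ideal (R Quot I) P'"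
proof safe
  let ?X' = "\<Union>f\<in>rmod_hom (R Quot I) P' (regular_rmodule (R Quot I)). f ` carrier P'"
  have reg: "right_module R (regular_rmodule R)" by (rule regular_right_module[OF I.ring_axioms])
  have am': "abelian_monoid (R Quot I)" by (rule P'.R.abelian_monoid_axioms)
  have X': "?X' \<subseteq> carrier (R Quot I)"
    by (auto simp: rmod_hom_def regular_rmodule_def)
  fix t assume "t \<in> trace_ideal R P"
  then show "I +>\<^bsub>R\<^esub> t \<in> trace_ideal (R Quot I) P'"
    unfolding trace_ideal_def using I.abelian_monoid_axioms
  proof (induction rule: finite_sums_induct)
    case (mem t)
    then obtain f x where f: "f \<in> rmod_hom R P (regular_rmodule R)" and x: "x \<in> carrier P" "t = f x"
      by blast
    have fc: "f x \<in> carrier R" if "x \<in> carrier P" for x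
      using rmod_homD(1)[OF f that] by (simp add: regular_rmodule_def)
    have f0: "f x \<in> I" if "x \<in> rmod_ideal_prod P I" for x
      using that[unfolded rmod_ideal_prod_def] right_module_abelian_monoid[OF P]
    proof (induction rule: finite_sums_induct)
      case (mem y)
      then obtain z a where za: "y = z \<star>\<^bsub>P\<^esub> a" "z \<in> carrier P" "a \<in> I" by blast
      have a: "a \<in> carrier R" using za I.a_subset by auto
      then show ?case
        using za rmod_homD(3)[OF f za(2) a] fc by (simp add: regular_rmodule_def I.I_l_closed)
    next
      case zero
      then show ?case using rmod_hom_zero[OF P reg f] by (simp add: regular_rmodule_def)
    next
      case (add x y)
      then show ?case using rmod_homD(2)[OF f] by (simp add: regular_rmodule_def)
    qed
    \<comment> \<open>Elements with equal image under \<open>\<Phi>\<close> differ by an element of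
      \<open>PI\<close>, so the class of \<open>f x\<close> depends on \<open>\<Phi> x\<close>
      alone.\<close>
    have wd: "I +>\<^bsub>R\<^esub> f x = I +>\<^bsub>R\<^esub> f y" if "x \<in> carrier P" "y \<in> carrier P" "\<Phi> x = \<Phi> y" for x y
    proof -
      have "f (x \<ominus>\<^bsub>P\<^esub> y) \<in> I" by (rule f0[OF diff_in_ideal_prod[OF that]])
      moreover have "f x = f (x \<ominus>\<^bsub>P\<^esub> y) \<oplus>\<^bsub>R\<^esub> f y"
        using rmod_homD(2)[OF f, of "x \<ominus>\<^bsub>P\<^esub> y" y] that
        by (simp add: regular_rmodule_def P.M.minus_eq P.M.a_assoc P.M.l_neg)
      ultimately have "f x \<in> I +>\<^bsub>R\<^esub> f y" by (auto simp: a_r_coset_def')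
      then show ?thesis using I.a_repr_independence[OF _ fc[OF that(2)] I.a_subgroup] by simp
    qed
    \<comment> \<open>A section of sets suffices: \<open>wd\<close> makes \<open>f'\<close>
      independent of the chosen preimages.\<close>
    define \<sigma> where "\<sigma> = inv_into (carrier P) \<Phi>"
    have \<sigma>: "\<sigma> v \<in> carrier P" "\<Phi> (\<sigma> v) = v" if "v \<in> carrier P'" for v
      using that surj inv_into_into[of v \<Phi> "carrier P"] f_inv_into_f[of v \<Phi> "carrier P"]
      by (auto simp: \<sigma>_def)
    define f' where "f' v = I +>\<^bsub>R\<^esub> f (\<sigma> v)" for v
    have f'\<Phi>: "f' (\<Phi> x) = I +>\<^bsub>R\<^esub> f x" if "x \<in> carrier P" for x
      unfolding f'_def using that \<sigma>[of "\<Phi> x"] surj by (intro wd) auto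
    have "f' \<in> rmod_hom (R Quot I) P' (regular_rmodule (R Quot I))"
    proof (rule rmod_homI)
      fix v assume v: "v \<in> carrier P'"
      then show "f' v \<in> carrier (regular_rmodule (R Quot I))"
        using \<sigma>(1)[OF v] fc by (auto simp: f'_def regular_rmodule_def I.FactRing_simps)
    next
      fix v w assume v: "v \<in> carrier P'" and w: "w \<in> carrier P'"
      have "f' (v \<oplus>\<^bsub>P'\<^esub> w) = f' (\<Phi> (\<sigma> v \<oplus>\<^bsub>P\<^esub> \<sigma> w))"
        using \<sigma>[OF v] \<sigma>[OF w] rmod_homD(2)[OF \<Phi>] by simp
      also have "\<dots> = f' v \<oplus>\<^bsub>R Quot I\<^esub> f' w"
        using \<sigma>[OF v] \<sigma>[OF w] rmod_homD(2)[OF f] fc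
        by (subst f'\<Phi>) (simp_all add: f'_def I.FactRing_simps regular_rmodule_def)
      finally show "f' (v \<oplus>\<^bsub>P'\<^esub> w) = f' v \<oplus>\<^bsub>regular_rmodule (R Quot I)\<^esub> f' w"
        by (simp add: regular_rmodule_def)
    next
      fix v A assume v: "v \<in> carrier P'" and A: "A \<in> carrier (R Quot I)"
      obtain a where a: "a \<in> carrier R" "A = I +>\<^bsub>R\<^esub> a" using A by (auto simp: I.FactRing_simps)
      have "f' (v \<star>\<^bsub>P'\<^esub> A) = f' (\<Phi> (\<sigma> v \<star>\<^bsub>P\<^esub> a))"
        using \<sigma>[OF v] a rmod_homD(3)[OF \<Phi>] by simp
      also have "\<dots> = f' v \<otimes>\<^bsub>R Quot I\<^esub> A"
        using \<sigma>[OF v] rmod_homD(3)[OF f] fc a ring_hom_mult[OF I.rcos_ring_hom]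
        by (subst f'\<Phi>) (simp_all add: f'_def regular_rmodule_def)
      finally show "f' (v \<star>\<^bsub>P'\<^esub> A) = f' v \<star>\<^bsub>regular_rmodule (R Quot I)\<^esub> A"
        by (simp add: regular_rmodule_def)
    qed
    moreover have "\<Phi> x \<in> carrier P'" using surj x(1) by blast
    ultimately have "f' (\<Phi> x) \<in> ?X'" by (intro UN_I[of f'] imageI)
    then have "I +>\<^bsub>R\<^esub> t \<in> finite_sums (R Quot I) ?X'"
      unfolding f'\<Phi>[OF x(1)] x(2)[symmetric] by (rule finite_sums_incl[OF am' X'])
    then show ?case using x fc by simp
  next
    case zero
    then show ?case
      using finite_sums_zero[OF am', of ?X'] I.a_coset_eq_ideal_iff[of "\<zero>\<^bsub>R\<^esub>"] by (simp add: I.FactRing_simps(1))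
  next
    case (add x y)
    then show ?case
      using finite_sums_add[OF am' X' add(3,4)] I.FactRing_simps(3)[OF add(1,2)] by simp
  qed
qed

text \<open>A functional on \<open>P'\<close> composed with \<open>\<Phi>\<close> is an
  \<open>R\<close>-linear map from \<open>P\<close> to \<open>R Quot I\<close>, which projectivity
  of \<open>P\<close> lifts to a functional with values in \<open>R\<close>.\<close>

lemma trace_quotient_supset:
  assumes proj: "projective_rmodule R P"
  shows "trace_ideal (R Quot I) P' \<subseteq> (\<lambda>t. I +>\<^bsub>R\<^esub> t) ` trace_ideal R P"
proof
  let ?X = "\<Union>f\<in>rmod_hom R P (regular_rmodule R). f ` carrier P"
  let ?S = "regular_rmodule (R Quot I)"
  let ?S' = "restrict_scalars (\<lambda>t. I +>\<^bsub>R\<^esub> t) ?S"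
  have reg: "right_module R (regular_rmodule R)" by (rule regular_right_module[OF I.ring_axioms])
  have am: "abelian_monoid R" by (rule I.abelian_monoid_axioms)
  have X: "?X \<subseteq> carrier R" by (auto simp: rmod_hom_def regular_rmodule_def)
  have S': "right_module R ?S'"
    by (rule restrict_scalars_right_module[OF I.ring_axioms _ I.rcos_ring_hom])
       (rule regular_right_module[OF P'.R.ring_axioms])
  have bar: "(\<lambda>t. I +>\<^bsub>R\<^esub> t) \<in> rmod_hom R (regular_rmodule R) ?S'"
    using I.rcos_ring_hom
    by (intro rmod_homI) (auto simp: regular_rmodule_def ring_hom_closed ring_hom_add ring_hom_mult)
  have bar_surj: "(\<lambda>t. I +>\<^bsub>R\<^esub> t) ` carrier (regular_rmodule R) = carrier ?S'"
    by (simp add: regular_rmodule_def I.FactRing_simps)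
  fix t assume "t \<in> trace_ideal (R Quot I) P'"
  then show "t \<in> (\<lambda>t. I +>\<^bsub>R\<^esub> t) ` trace_ideal R P"
    unfolding trace_ideal_def using P'.R.abelian_monoid_axioms
  proof (induction rule: finite_sums_induct)
    case (mem t)
    then obtain f v where f: "f \<in> rmod_hom (R Quot I) P' ?S" and v: "v \<in> carrier P'" "t = f v"
      by blast
    have "f \<in> rmod_hom R (restrict_scalars (\<lambda>t. I +>\<^bsub>R\<^esub> t) P') ?S'"
      by (rule restrict_scalars_hom[OF I.rcos_ring_hom f])
    from rmod_hom_comp[OF \<Phi> this]
    obtain h where h: "h \<in> rmod_hom R P (regular_rmodule R)"
      "\<And>x. x \<in> carrier P \<Longrightarrow> I +>\<^bsub>R\<^esub> h x = f (\<Phi> x)"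
      using projective_rmodule_lift[OF proj reg S' bar bar_surj] by metis
    obtain x where x: "x \<in> carrier P" "\<Phi> x = v" using surj v by (metis imageE)
    have "h x \<in> finite_sums R ?X" using finite_sums_incl[OF am X] h(1) x(1) by blast
    then show ?case
      using h(2)[OF x(1)] x v rmod_homD(1)[OF f v(1)] by (auto simp: regular_rmodule_def)
  next
    case zero
    have "I +>\<^bsub>R\<^esub> \<zero>\<^bsub>R\<^esub> = \<zero>\<^bsub>R Quot I\<^esub>" using I.a_coset_eq_ideal_iff[of "\<zero>\<^bsub>R\<^esub>"] by (simp add: I.FactRing_simps(1))
    then show ?case using finite_sums_zero[OF am] by (metis imageI)
  next
    case (add x y)
    then obtain a b where ab: "x = I +>\<^bsub>R\<^esub> a" "y = I +>\<^bsub>R\<^esub> b" "a \<in> finite_sums R ?X" "b \<in> finite_sums R ?X"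
      by blast
    moreover have "a \<in> carrier R" "b \<in> carrier R" using ab finite_sums_carrier[OF am X] by auto
    ultimately show ?case
      using finite_sums_add[OF am X ab(3,4)] I.FactRing_simps(3) by (metis imageI)
  qed
qed

end

section \<open>Matrices of the given modules\<close>

text \<open>\<open>Q\<close> is a retract of \<open>F\<close> via \<open>s\<close> and
  \<open>t\<close>, and \<open>\<epsilon>\<close> is the idempotent \<open>s t\<close>, whose image
  is a copy of \<open>Q\<close>. The last property says that vectors with entries in the trace are
  sums of values of maps through \<open>Q\<close>; it later provides the factorisation of
  \<open>A\<^sup>2 - A\<close>.\<close>

lemma trace_ideal_idempotent:
  fixes R :: "('a, 'r) ring_scheme" and Q :: "('a, 'c) rmodule"
  defines "F \<equiv> free_rmodule R (UNIV :: nat set)"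
  assumes proj: "projective_rmodule R Q" and cg: "countably_generated_rmodule R Q"
  obtains \<epsilon> where "\<epsilon> \<in> rmod_hom R F F" "\<And>x. x \<in> carrier F \<Longrightarrow> \<epsilon> (\<epsilon> x) = \<epsilon> x"
    "\<And>x k. x \<in> carrier F \<Longrightarrow> \<epsilon> x k \<in> trace_ideal R Q"
    "\<And>x. x \<in> carrier F \<Longrightarrow> \<forall>k. x k \<in> trace_ideal R Q \<Longrightarrow>
       x \<in> finite_sums F {h (\<epsilon> g) | h g. h \<in> rmod_hom R F F \<and> g \<in> carrier F}"
proof -
  have Q: "right_module R Q" using proj by (simp add: projective_rmodule_def)
  interpret Q: right_module R Q by (rule Q)
  have R: "ring R" by (rule Q.R.ring_axioms)
  have F: "right_module R F" unfolding F_def using R by (rule free_rmodule_right_module)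
  interpret F: right_module R F by (rule F)
  have reg: "right_module R (regular_rmodule R)" using R by (rule regular_right_module)
  obtain s t where s: "s \<in> rmod_hom R Q F" and t: "t \<in> rmod_hom R F Q"
    and ts: "\<And>x. x \<in> carrier Q \<Longrightarrow> t (s x) = x"
    using countably_generated_projective_retract[OF proj cg] unfolding F_def by metis
  define \<epsilon> where "\<epsilon> x = s (t x)" for x
  have \<epsilon>: "\<epsilon> \<in> rmod_hom R F F" unfolding \<epsilon>_def by (rule rmod_hom_comp[OF t s])
  let ?X = "\<Union>f\<in>rmod_hom R Q (regular_rmodule R). f ` carrier Q"
  have X: "?X \<subseteq> carrier R" by (auto simp: rmod_hom_def regular_rmodule_def)
  have inI: "\<epsilon> x k \<in> trace_ideal R Q" if "x \<in> carrier F" for x k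
  proof -
    \<comment> \<open>Each coordinate of \<open>s\<close> is a functional on
      \<open>Q\<close>.\<close>
    have "(\<lambda>x. s x k) \<in> rmod_hom R Q (regular_rmodule R)"
      by (rule rmod_hom_comp[OF s[unfolded F_def] free_coord_hom])
    then have "\<epsilon> x k \<in> ?X" unfolding \<epsilon>_def using rmod_homD(1)[OF t that] by blast
    then show ?thesis
      unfolding trace_ideal_def by (rule finite_sums_incl[OF Q.R.abelian_monoid_axioms X])
  qed
  let ?Y = "{h (\<epsilon> g) | h g. h \<in> rmod_hom R F F \<and> g \<in> carrier F}"
  have Y: "?Y \<subseteq> carrier F"
  proof safe
    fix h g assume "h \<in> rmod_hom R F F" "g \<in> carrier F"
    then show "h (\<epsilon> g) \<in> carrier F" using rmod_homD(1)[OF \<epsilon>] by (intro rmod_homD(1)[of h R F F])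
  qed
  note amF = F.M.abelian_monoid_axioms
  have b: "free_basis R k \<in> carrier F" for k unfolding F_def by (rule free_basis_closed[OF R]) simp
  have bI: "free_basis R k \<star>\<^bsub>F\<^esub> a \<in> finite_sums F ?Y" if a: "a \<in> trace_ideal R Q" for k a
    using a[unfolded trace_ideal_def] Q.R.abelian_monoid_axioms
  proof (induction rule: finite_sums_induct)
    case (mem a)
    then obtain f q where f: "f \<in> rmod_hom R Q (regular_rmodule R)" "q \<in> carrier Q" "a = f q" by blast
    have m: "(\<lambda>a. free_basis R k \<star>\<^bsub>F\<^esub> a) \<in> rmod_hom R (regular_rmodule R) F"
      using b by (intro rmod_homI) (auto simp: regular_rmodule_def F.rsmult_r_distr F.rsmult_assoc)
    \<comment> \<open>The endomorphism sending \<open>x\<close> to the basis vector times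
      \<open>f (t x)\<close> realises the value \<open>f q\<close> at
      \<open>\<epsilon> (s q)\<close>, because \<open>t\<close> maps that vector back to
      \<open>q\<close>.\<close>
    have h: "(\<lambda>x. free_basis R k \<star>\<^bsub>F\<^esub> f (t x)) \<in> rmod_hom R F F"
      by (rule rmod_hom_comp[OF rmod_hom_comp[OF t f(1)] m])
    have sq: "s q \<in> carrier F" using rmod_homD(1)[OF s f(2)] .
    have "t (\<epsilon> (s q)) = q" using ts f(2) by (simp add: \<epsilon>_def)
    then have "free_basis R k \<star>\<^bsub>F\<^esub> a = (\<lambda>x. free_basis R k \<star>\<^bsub>F\<^esub> f (t x)) (\<epsilon> (s q))" using f by simp
    then have Y': "free_basis R k \<star>\<^bsub>F\<^esub> a \<in> ?Y"
      using h sq by (intro CollectI exI[of _ "\<lambda>x. free_basis R k \<star>\<^bsub>F\<^esub> f (t x)"] exI[of _ "s q"] conjI)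
    have "a \<in> carrier R" using X mem by (rule subsetD)
    with finite_sums_incl[OF amF Y Y'] show ?case by (rule conjI[rotated])
  next
    case zero
    then show ?case using finite_sums_zero[OF amF] b by simp
  next
    case (add x y)
    then show ?case using finite_sums_add[OF amF Y] b by (simp add: F.rsmult_r_distr)
  qed
  have idF: "(\<lambda>x. x) \<in> rmod_hom R (free_rmodule R UNIV) F" unfolding F_def by (rule rmod_hom_id)
  \<comment> \<open>The identity of \<open>F\<close> writes \<open>x\<close> as the sum of basis
    vectors times coordinates, and \<open>bI\<close> covers each term.\<close>
  have "x \<in> finite_sums F ?Y" if "x \<in> carrier F" "\<forall>k. x k \<in> trace_ideal R Q" for x
    by (rule free_hom_in[OF F idF that(1)[unfolded F_def] finite_sums_carrier[OF amF Y]
          finite_sums_zero[OF amF] finite_sums_add[OF amF Y]])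
       (use that(2) bI in auto)
  then show ?thesis
    using that[OF \<epsilon>] ts rmod_homD(1)[OF t] inI by (simp add: \<epsilon>_def)
qed

text \<open>\<open>P'\<close> is a retract, via \<open>s\<close> and \<open>t\<close>, of a free
  \<open>R Quot I\<close>-module. \<open>\<pi>\<close> is reduction modulo \<open>I\<close> followed
  by \<open>t\<close>, and \<open>A\<close> lifts the idempotent \<open>s t\<close>. Since
  \<open>t s\<close> is the identity, \<open>\<pi> A = \<pi>\<close>; since \<open>A x\<close>
  reduces to \<open>s (\<pi> x)\<close>, its entries lie in \<open>I\<close> when
  \<open>\<pi> x\<close> is zero.\<close>

lemma projective_quotient_lift:
  fixes R :: "('a, 'r) ring_scheme" and P' :: "('a set, 'b) rmodule"
  defines "F \<equiv> free_rmodule R (UNIV :: nat set)"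
  assumes I: "ideal I R"
    and proj: "projective_rmodule (R Quot I) P'" and cg: "countably_generated_rmodule (R Quot I) P'"
  obtains \<pi> A where "\<pi> \<in> rmod_hom R F (restrict_scalars (\<lambda>t. I +>\<^bsub>R\<^esub> t) P')"
    "\<pi> ` carrier F = carrier P'" "A \<in> rmod_hom R F F"
    "\<And>x. x \<in> carrier F \<Longrightarrow> \<pi> (A x) = \<pi> x"
    "\<And>x k. x \<in> carrier F \<Longrightarrow> \<pi> x = \<zero>\<^bsub>P'\<^esub> \<Longrightarrow> A x k \<in> I"
proof -
  interpret I: ideal I R by (rule I)
  have P': "right_module (R Quot I) P'" using proj by (simp add: projective_rmodule_def)
  have R: "ring R" by (rule I.ring_axioms)
  have S: "ring (R Quot I)" using P' by (simp add: right_module_def)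
  let ?\<phi> = "\<lambda>t. I +>\<^bsub>R\<^esub> t"
  let ?F' = "free_rmodule (R Quot I) (UNIV :: nat set)"
  have F': "right_module (R Quot I) ?F'" using S by (rule free_rmodule_right_module)
  have F: "right_module R F" unfolding F_def using R by (rule free_rmodule_right_module)
  note \<phi> = I.rcos_ring_hom
  have F'R: "right_module R (restrict_scalars ?\<phi> ?F')"
    by (rule restrict_scalars_right_module[OF R F' \<phi>])
  obtain s t where s: "s \<in> rmod_hom (R Quot I) P' ?F'" and t: "t \<in> rmod_hom (R Quot I) ?F' P'"
    and ts: "\<And>x. x \<in> carrier P' \<Longrightarrow> t (s x) = x"
    using countably_generated_projective_retract[OF proj cg] by metis
  define bar where "bar x = (\<lambda>k::nat. I +>\<^bsub>R\<^esub> x k)" for x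
  have z: "I +>\<^bsub>R\<^esub> \<zero>\<^bsub>R\<^esub> = \<zero>\<^bsub>R Quot I\<^esub>" using I.a_coset_eq_ideal_iff by (simp add: I.FactRing_simps(1))
  have bar: "bar \<in> rmod_hom R F (restrict_scalars ?\<phi> ?F')"
  proof (rule rmod_homI)
    fix x assume x: "x \<in> carrier F"
    have "{k. bar x k \<noteq> \<zero>\<^bsub>R Quot I\<^esub>} \<subseteq> {k. x k \<noteq> \<zero>\<^bsub>R\<^esub>}"
      using z by (intro Collect_mono impI notI) (simp add: bar_def)
    with x finite_subset[OF this] show "bar x \<in> carrier (restrict_scalars ?\<phi> ?F')"
      by (auto simp: F_def free_rmodule_def bar_def I.FactRing_simps(2))
  qed (auto simp: F_def free_rmodule_def bar_def ring_hom_add[OF \<phi>] ring_hom_mult[OF \<phi>])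
  have bar_surj: "carrier (restrict_scalars ?\<phi> ?F') \<subseteq> bar ` carrier F"
  proof
    fix y assume "y \<in> carrier (restrict_scalars ?\<phi> ?F')"
    then have y: "y k \<in> carrier (R Quot I)" "finite {k. y k \<noteq> \<zero>\<^bsub>R Quot I\<^esub>}" for k
      by (auto simp: free_rmodule_def)
    \<comment> \<open>Zero coordinates are lifted to zero, which keeps the support of the lift
      finite.\<close>
    have "\<exists>a. a \<in> carrier R \<and> I +>\<^bsub>R\<^esub> a = y k \<and> (y k = \<zero>\<^bsub>R Quot I\<^esub> \<longrightarrow> a = \<zero>\<^bsub>R\<^esub>)" for k
      using y(1)[of k] z I.zero_closed unfolding I.FactRing_simps(2) by (metis imageE)
    then obtain x where x: "\<And>k. x k \<in> carrier R" "\<And>k. I +>\<^bsub>R\<^esub> x k = y k"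
      "\<And>k. y k = \<zero>\<^bsub>R Quot I\<^esub> \<Longrightarrow> x k = \<zero>\<^bsub>R\<^esub>" by metis
    have "{k. x k \<noteq> \<zero>\<^bsub>R\<^esub>} \<subseteq> {k. y k \<noteq> \<zero>\<^bsub>R Quot I\<^esub>}" using x(3) by auto
    from finite_subset[OF this y(2)] have "x \<in> carrier F" using x by (simp add: F_def free_rmodule_def)
    moreover have "bar x = y" using x by (auto simp: bar_def)
    ultimately show "y \<in> bar ` carrier F" by blast
  qed
  define \<pi> where "\<pi> x = t (bar x)" for x
  have tR: "t \<in> rmod_hom R (restrict_scalars ?\<phi> ?F') (restrict_scalars ?\<phi> P')"
    by (rule restrict_scalars_hom[OF \<phi> t])
  have sR: "s \<in> rmod_hom R (restrict_scalars ?\<phi> P') (restrict_scalars ?\<phi> ?F')"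
    by (rule restrict_scalars_hom[OF \<phi> s])
  have \<pi>: "\<pi> \<in> rmod_hom R F (restrict_scalars ?\<phi> P')" unfolding \<pi>_def by (rule rmod_hom_comp[OF bar tR])
  have \<pi>c: "\<pi> x \<in> carrier P'" if "x \<in> carrier F" for x using rmod_homD(1)[OF \<pi> that] by simp
  have "\<pi> ` carrier F = carrier P'"
  proof
    show "carrier P' \<subseteq> \<pi> ` carrier F"
    proof
      fix v assume v: "v \<in> carrier P'"
      then obtain x where "x \<in> carrier F" "bar x = s v"
        using bar_surj rmod_homD(1)[OF s v] by (metis imageE restrict_scalars_simps(1) subsetD)
      then show "v \<in> \<pi> ` carrier F" using ts[OF v] by (metis \<pi>_def imageI)
    qed
  qed (use \<pi>c in auto)
  moreover obtain A where A: "A \<in> rmod_hom R F F" "\<And>x. x \<in> carrier F \<Longrightarrow> bar (A x) = s (\<pi> x)"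
    using free_lift[OF F F'R bar bar_surj, of "\<lambda>x. s (\<pi> x)" UNIV] rmod_hom_comp[OF \<pi> sR]
    unfolding F_def by metis
  moreover have "\<pi> (A x) = \<pi> x" if "x \<in> carrier F" for x
    using A(2)[OF that] ts[OF \<pi>c[OF that]] by (simp add: \<pi>_def)
  moreover have "A x k \<in> I" if x: "x \<in> carrier F" and 0: "\<pi> x = \<zero>\<^bsub>P'\<^esub>" for x k
  proof -
    have "bar (A x) = \<zero>\<^bsub>?F'\<^esub>" using A(2)[OF x] 0 rmod_hom_zero[OF P' F' s] by simp
    then have "I +>\<^bsub>R\<^esub> A x k = I"
      by (simp add: bar_def free_rmodule_def fun_eq_iff I.FactRing_simps(1))
    moreover have "A x k \<in> carrier R" using rmod_homD(1)[OF A(1) x] by (simp add: F_def free_rmodule_def)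
    ultimately show ?thesis using I.a_coset_eq_ideal_iff by metis
  qed
  ultimately show ?thesis using that \<pi> by metis
qed

section \<open>Images of idempotents and copowers\<close>

lemma submodule_right_module:
  fixes R :: "('a, 'r) ring_scheme" and M :: "('a, 'b) rmodule"
  assumes M: "right_module R M" and S: "S \<subseteq> carrier M" "\<zero>\<^bsub>M\<^esub> \<in> S"
    "\<And>x y. x \<in> S \<Longrightarrow> y \<in> S \<Longrightarrow> x \<oplus>\<^bsub>M\<^esub> y \<in> S"
    "\<And>x a. x \<in> S \<Longrightarrow> a \<in> carrier R \<Longrightarrow> x \<star>\<^bsub>M\<^esub> a \<in> S"
  shows "right_module R (M\<lparr>carrier := S\<rparr>)"
proof -
  interpret M: right_module R M by fact
  have "abelian_group (M\<lparr>carrier := S\<rparr>)"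
  proof (rule abelian_groupI)
    fix x assume "x \<in> carrier (M\<lparr>carrier := S\<rparr>)"
    then have x: "x \<in> S" by simp
    \<comment> \<open>The negative of \<open>x\<close> is \<open>x\<close> times minus one, so
      closure under scalars supplies additive inverses.\<close>
    have "x \<star>\<^bsub>M\<^esub> (\<ominus>\<^bsub>R\<^esub> \<one>\<^bsub>R\<^esub>) \<oplus>\<^bsub>M\<^esub> x = \<zero>\<^bsub>M\<^esub>"
      using x S(1) by (auto simp: M.rsmult_minus_right M.M.l_neg subset_iff)
    then show "\<exists>y\<in>carrier (M\<lparr>carrier := S\<rparr>). y \<oplus>\<^bsub>M\<lparr>carrier := S\<rparr>\<^esub> x = \<zero>\<^bsub>M\<lparr>carrier := S\<rparr>\<^esub>"
      using S(4)[OF x, of "\<ominus>\<^bsub>R\<^esub> \<one>\<^bsub>R\<^esub>"] by (intro bexI[of _ "x \<star>\<^bsub>M\<^esub> (\<ominus>\<^bsub>R\<^esub> \<one>\<^bsub>R\<^esub>)"]) auto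
  qed (use S in \<open>auto simp: M.M.a_ac subset_iff\<close>)
  then show ?thesis
    by (intro right_module.intro right_module_axioms.intro)
       (use M.R.ring_axioms S in \<open>auto simp: M.rsmult_l_distr M.rsmult_r_distr M.rsmult_assoc subset_iff\<close>)
qed

text \<open>\<open>p\<close> retracts \<open>F\<close> onto \<open>P\<close>, so lifting problems
  for \<open>P\<close> are solved on \<open>F\<close> and restricted, and the images of the basis
  vectors generate \<open>P\<close>.\<close>

lemma idempotent_image:
  fixes R :: "('a, 'r) ring_scheme"
  defines "F \<equiv> free_rmodule R (UNIV :: nat set)"
  assumes R: "ring R" and p: "p \<in> rmod_hom R F F"
    and idem: "\<And>x. x \<in> carrier F \<Longrightarrow> p (p x) = p x"
  defines "P \<equiv> F\<lparr>carrier := p ` carrier F\<rparr>"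
  shows "right_module R P" "p \<in> rmod_hom R F P" "projective_rmodule R P"
    "countably_generated_rmodule R P"
proof -
  have F: "right_module R F" unfolding F_def using R by (rule free_rmodule_right_module)
  interpret F: right_module R F by (rule F)
  show P: "right_module R P" unfolding P_def
  proof (rule submodule_right_module[OF F])
    show "\<zero>\<^bsub>F\<^esub> \<in> p ` carrier F" using rmod_hom_zero[OF F F p] F.M.zero_closed by (metis imageI)
  next
    fix x y assume "x \<in> p ` carrier F" "y \<in> p ` carrier F"
    then obtain x' y' where "x = p x'" "y = p y'" "x' \<in> carrier F" "y' \<in> carrier F" by blast
    then show "x \<oplus>\<^bsub>F\<^esub> y \<in> p ` carrier F" using rmod_homD(2)[OF p] F.M.a_closed by (metis imageI)
  next
    fix x a assume "x \<in> p ` carrier F" "a \<in> carrier R"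
    then obtain x' where "x = p x'" "x' \<in> carrier F" "a \<in> carrier R" by blast
    then show "x \<star>\<^bsub>F\<^esub> a \<in> p ` carrier F" using rmod_homD(3)[OF p] F.rsmult_closed by (metis imageI)
  qed (use rmod_homD(1)[OF p] in auto)
  interpret P: right_module R P by (rule P)
  show pP: "p \<in> rmod_hom R F P"
    unfolding P_def using rmod_homD[OF p] by (intro rmod_homI) auto
  show "projective_rmodule R P"
    unfolding projective_rmodule_def
  proof (intro conjI P allI impI ballI)
    fix M :: "('a, (nat \<Rightarrow> 'a) \<Rightarrow> 'a) rmodule" and N :: "('a, nat \<Rightarrow> 'a) rmodule" and g f
    assume M: "right_module R M" and N: "right_module R N" and g: "g \<in> rmod_hom R M N"
      and f: "f \<in> rmod_hom R P N" and surj: "g ` carrier M = carrier N"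
    obtain h where h: "h \<in> rmod_hom R F M" "\<And>x. x \<in> carrier F \<Longrightarrow> g (h x) = f (p x)"
      using free_lift[OF M N g _ rmod_hom_comp[OF pP[unfolded F_def] f]] surj
      unfolding F_def by blast
    have sub: "carrier P \<subseteq> carrier F" using rmod_homD(1)[OF p] by (auto simp: P_def)
    have P_ops: "x \<oplus>\<^bsub>P\<^esub> y = x \<oplus>\<^bsub>F\<^esub> y" "x \<star>\<^bsub>P\<^esub> a = x \<star>\<^bsub>F\<^esub> a" for x y a by (simp_all add: P_def)
    have "h \<in> rmod_hom R P M"
      using rmod_homD[OF h(1)] sub P_ops by (intro rmod_homI) (simp_all add: subset_iff)
    moreover have "g (h x) = f x" if "x \<in> carrier P" for x
      using that h(2)[of x] sub idem by (auto simp: P_def)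
    ultimately show "\<exists>h\<in>rmod_hom R P M. \<forall>x\<in>carrier P. g (h x) = f x" by blast
  qed
  show "countably_generated_rmodule R P"
    unfolding countably_generated_rmodule_def
  proof (intro exI conjI)
    let ?X = "range (\<lambda>k. p (free_basis R k))"
    let ?Y = "{x \<star>\<^bsub>P\<^esub> a | x a. x \<in> ?X \<and> a \<in> carrier R}"
    show "countable ?X" by simp
    have b: "free_basis R k \<in> carrier F" for k unfolding F_def by (rule free_basis_closed[OF R]) simp
    show X: "?X \<subseteq> carrier P" using b by (auto simp: P_def)
    have Y: "?Y \<subseteq> carrier P" using X by auto
    note am = P.M.abelian_monoid_axioms
    have "p x \<in> finite_sums P ?Y" if x: "x \<in> carrier F" for x
    proof (rule free_hom_in[OF P pP[unfolded F_def] x[unfolded F_def]])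
      show "p (free_basis R k) \<star>\<^bsub>P\<^esub> x k \<in> finite_sums P ?Y" for k
        using x by (intro finite_sums_incl[OF am Y]) (auto simp: F_def free_rmodule_def)
    qed (use finite_sums_carrier[OF am Y] finite_sums_zero[OF am] finite_sums_add[OF am Y] in auto)
    then show "carrier P = finite_sums P ?Y"
      using finite_sums_carrier[OF am Y] by (auto simp: P_def)
  qed
qed

text \<open>
  A bijection \<open>c\<close> from \<open>'z \<times> nat\<close> to \<open>nat\<close> makes the free module on \<open>nat\<close> a direct sum of copies of
  itself indexed by \<open>'z\<close>.
\<close>

definition copow_in :: "('a, 'r) ring_scheme \<Rightarrow> ('z \<times> nat \<Rightarrow> nat) \<Rightarrow> 'z \<Rightarrow> (nat \<Rightarrow> 'a) \<Rightarrow> nat \<Rightarrow> 'a" where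
  "copow_in R c z = free_eval R (free_rmodule R UNIV) (\<lambda>i. free_basis R (c (z, i)))"

text \<open>The homomorphism with component \<open>f z\<close> on the copy \<open>z\<close>;
  decoding \<open>s\<close> by the inverse of \<open>c\<close> tells which copy a basis vector
  belongs to.\<close>

definition copow_out ::
    "[('a, 'r) ring_scheme, ('a, 'b, 'm) rmodule_scheme, 'z \<times> nat \<Rightarrow> nat, 'z \<Rightarrow> (nat \<Rightarrow> 'a) \<Rightarrow> 'b]
      \<Rightarrow> (nat \<Rightarrow> 'a) \<Rightarrow> 'b" where
  "copow_out R M c f = free_eval R M (\<lambda>s. case inv_into UNIV c s of (z, i) \<Rightarrow> f z (free_basis R i))"

context
  fixes R :: "('a, 'r) ring_scheme" and c :: "'z \<times> nat \<Rightarrow> nat" and F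
  defines "F \<equiv> free_rmodule R (UNIV :: nat set)"
  assumes R: "ring R" and c: "bij c"
begin

lemma copow_module: "right_module R F"
  unfolding F_def using R by (rule free_rmodule_right_module)

lemma copow_basis_closed: "free_basis R k \<in> carrier F"
  unfolding F_def by (rule free_basis_closed[OF R]) simp

lemma copow_in_hom: "copow_in R c z \<in> rmod_hom R F F"
  unfolding copow_in_def F_def
  using copow_module copow_basis_closed unfolding F_def by (rule free_eval_hom)

lemma copow_in_basis: "copow_in R c z (free_basis R i) = free_basis R (c (z, i))"
  using free_eval_basis[OF copow_module, of "\<lambda>i. free_basis R (c (z, i))" i, OF copow_basis_closed]
  by (simp add: copow_in_def F_def)

lemma copow_out_hom:
  assumes M: "right_module R M" and f: "\<And>z. f z \<in> rmod_hom R F M"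
  shows "copow_out R M c f \<in> rmod_hom R F M"
  unfolding copow_out_def F_def
  by (rule free_eval_hom[OF M]) (use rmod_homD(1)[OF f copow_basis_closed] in \<open>auto split: prod.split\<close>)

lemma copow_out_in:
  assumes M: "right_module R M" and f: "\<And>z. f z \<in> rmod_hom R F M" and x: "x \<in> carrier F"
  shows "copow_out R M c f (copow_in R c z x) = f z x"
proof (rule free_hom_ext[OF M _ _ _ x[unfolded F_def]])
  show "(\<lambda>x. copow_out R M c f (copow_in R c z x)) \<in> rmod_hom R (free_rmodule R UNIV) M"
    using rmod_hom_comp[OF copow_in_hom copow_out_hom[OF M f]] unfolding F_def .
  show "f z \<in> rmod_hom R (free_rmodule R UNIV) M" using f unfolding F_def .
next
  fix i :: nat
  have "inv_into UNIV c (c (z, i)) = (z, i)" using c by (simp add: bij_is_inj)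
  then show "copow_out R M c f (copow_in R c z (free_basis R i)) = f z (free_basis R i)"
    unfolding copow_in_basis copow_out_def
    by (subst free_eval_basis[OF M]) (use rmod_homD(1)[OF f copow_basis_closed] in auto)
qed

lemma basis_copow_in:
  obtains z i where "free_basis R k = copow_in R c z (free_basis R i)"
proof -
  obtain z i where "k = c (z, i)" using c by (metis bij_pointE surj_pair)
  then show ?thesis using that copow_in_basis by metis
qed

lemma copow_ext:
  assumes M: "right_module R M" and g: "g \<in> rmod_hom R F M" and h: "h \<in> rmod_hom R F M"
    and eq: "\<And>z x. x \<in> carrier F \<Longrightarrow> g (copow_in R c z x) = h (copow_in R c z x)"
    and y: "y \<in> carrier F"
  shows "g y = h y"
proof (rule free_hom_ext[OF M g[unfolded F_def] h[unfolded F_def] _ y[unfolded F_def]])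
  fix k :: nat
  show "g (free_basis R k) = h (free_basis R k)"
    using basis_copow_in[of k] eq copow_basis_closed by metis
qed

lemma copow_hom_in:
  assumes M: "right_module R M" and g: "g \<in> rmod_hom R F M"
    and S: "S \<subseteq> carrier M" "\<zero>\<^bsub>M\<^esub> \<in> S" "\<And>x y. x \<in> S \<Longrightarrow> y \<in> S \<Longrightarrow> x \<oplus>\<^bsub>M\<^esub> y \<in> S"
    and b: "\<And>z x. x \<in> carrier F \<Longrightarrow> g (copow_in R c z x) \<in> S"
    and y: "y \<in> carrier F"
  shows "g y \<in> S"
proof (rule free_hom_in[OF M g[unfolded F_def] y[unfolded F_def] S])
  interpret F: right_module R F by (rule copow_module)
  fix k :: nat
  obtain z i where zi: "free_basis R k = copow_in R c z (free_basis R i)" by (rule basis_copow_in)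
  have yk: "y k \<in> carrier R" using y by (simp add: F_def free_rmodule_def)
  \<comment> \<open>The scalar is moved inside \<open>copow_in\<close>, where \<open>b\<close>
    applies; \<open>S\<close> is only known to be closed under sums.\<close>
  have "g (free_basis R k) \<star>\<^bsub>M\<^esub> y k = g (copow_in R c z (free_basis R i \<star>\<^bsub>F\<^esub> y k))"
    using zi rmod_homD(3)[OF g copow_basis_closed[of k] yk] rmod_homD(3)[OF copow_in_hom copow_basis_closed yk, of z i] by simp
  then show "g (free_basis R k) \<star>\<^bsub>M\<^esub> y k \<in> S" using b copow_basis_closed yk by simp
qed auto

end

text \<open>The cancellation behind \<open>r_j_\<iota>\<close>, where \<open>d\<close>,
  \<open>w\<close>, \<open>v\<close> are \<open>D k (A x)\<close>,
  \<open>\<iota> (Suc k) (A x)\<close> and \<open>D (Suc k) (A (A x))\<close>.\<close>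

lemma (in abelian_group) telescope_cancel:
  assumes "x \<in> carrier G" "d \<in> carrier G" "w \<in> carrier G" "v \<in> carrier G"
  shows "((x \<ominus> d) \<ominus> (w \<ominus> v)) \<ominus> (v \<ominus> (d \<oplus> w)) = x"
proof -
  have "(x \<ominus> d) \<ominus> (w \<ominus> v) = x \<oplus> (v \<ominus> (d \<oplus> w))"
    using assms by (simp add: minus_eq minus_add a_ac)
  then show ?thesis
    using assms by (simp add: minus_eq a_assoc r_neg)
qed

section \<open>Lifting an idempotent modulo a trace ideal\<close>

text \<open>\<open>x\<close> is the sum of basis vectors times entries from \<open>I\<close>, so
  \<open>f x\<close> is a sum of elements of \<open>N\<close> times elements of
  \<open>I\<close>.\<close>

lemma hom_mem_ideal_prod:
  assumes N: "right_module R N" and I: "ideal I R" and f: "f \<in> rmod_hom R (free_rmodule R X) N"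
    and x: "x \<in> carrier (free_rmodule R X)" and xI: "\<And>k. k \<in> X \<Longrightarrow> x k \<in> I"
  shows "f x \<in> rmod_ideal_prod N I"
proof (rule free_hom_in[OF N f x])
  fix k assume k: "k \<in> X"
  have "ring R" using N by (simp add: right_module_def)
  from rmod_homD(1)[OF f free_basis_closed[OF this k]]
  show "f (free_basis R k) \<star>\<^bsub>N\<^esub> x k \<in> rmod_ideal_prod N I"
    by (rule rmod_ideal_prod_closed(4)[OF N I _ xI[OF k]])
qed (use rmod_ideal_prod_closed[OF N I] in auto)

lemma (in abelian_group) add_diff_cancel:
  assumes "x \<in> carrier G" "y \<in> carrier G"
  shows "y \<oplus> (x \<ominus> y) = x"
proof -
  have "y \<oplus> (x \<ominus> y) = x \<oplus> (y \<oplus> \<ominus> y)"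
    unfolding minus_eq using assms by (intro a_lcomm) auto
  then show ?thesis using assms by (simp add: r_neg)
qed

lemma (in abelian_group) eq_add_if_minus_minus_zero:
  assumes "a \<in> carrier G" "b \<in> carrier G" "c \<in> carrier G" "\<zero> = (a \<ominus> b) \<ominus> c"
  shows "a = c \<oplus> b"
proof -
  have "((a \<ominus> b) \<ominus> c) \<oplus> (c \<oplus> b) = a"
    using assms(1-3) by (simp add: minus_eq a_assoc r_neg1 l_neg)
  then show ?thesis using assms by (metis l_zero add.m_closed)
qed

lemma submodule_incl_hom:
  "S \<subseteq> carrier M \<Longrightarrow> f \<in> rmod_hom R M N \<Longrightarrow> f \<in> rmod_hom R (M\<lparr>carrier := S\<rparr>) N"
  by (auto simp: rmod_hom_def subset_iff)

text \<open>
  \<open>M'\<close> is \<open>P'\<close> with scalars restricted to \<open>R\<close>, and the image of \<open>\<epsilon>\<close> is \<open>Q\<close>. The index type of the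
  copower has a copy of \<open>F\<close> for each stage \<open>k\<close> of the colimit, a copy \<open>(k, i, l)\<close> for the \<open>l\<close>-th summand
  in the factorisation of the \<open>i\<close>-th column of \<open>A\<^sup>2 - A\<close> at stage \<open>k\<close>, and the spare copy \<open>None\<close>.
\<close>

locale idempotent_lifting =
  fixes R :: "('a, 'r) ring_scheme" and I :: "'a set" and M' :: "('a, 'b) rmodule"
    and \<pi> :: "(nat \<Rightarrow> 'a) \<Rightarrow> 'b" and A \<epsilon> :: "(nat \<Rightarrow> 'a) \<Rightarrow> nat \<Rightarrow> 'a"
    and n :: "nat \<Rightarrow> nat" and h :: "nat \<Rightarrow> nat \<Rightarrow> (nat \<Rightarrow> 'a) \<Rightarrow> nat \<Rightarrow> 'a"
    and g :: "nat \<Rightarrow> nat \<Rightarrow> nat \<Rightarrow> 'a"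
    and c :: "(nat + (nat \<times> nat \<times> nat) option) \<times> nat \<Rightarrow> nat"
    and F :: "('a, nat \<Rightarrow> 'a) rmodule"
  assumes F_def: "F = free_rmodule R UNIV"
    and I: "ideal I R" and M': "right_module R M'"
    and M'I: "\<And>v a. v \<in> carrier M' \<Longrightarrow> a \<in> I \<Longrightarrow> v \<star>\<^bsub>M'\<^esub> a = \<zero>\<^bsub>M'\<^esub>"
    and \<pi>: "\<pi> \<in> rmod_hom R F M'" and \<pi>_surj: "\<pi> ` carrier F = carrier M'"
    and A: "A \<in> rmod_hom R F F"
    and \<pi>A: "\<And>x. x \<in> carrier F \<Longrightarrow> \<pi> (A x) = \<pi> x"
    and A_ker: "\<And>x k. x \<in> carrier F \<Longrightarrow> \<pi> x = \<zero>\<^bsub>M'\<^esub> \<Longrightarrow> A x k \<in> I"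
    and \<epsilon>: "\<epsilon> \<in> rmod_hom R F F" and \<epsilon>\<epsilon>: "\<And>x. x \<in> carrier F \<Longrightarrow> \<epsilon> (\<epsilon> x) = \<epsilon> x"
    and \<epsilon>I: "\<And>x k. x \<in> carrier F \<Longrightarrow> \<epsilon> x k \<in> I"
    and gen: "\<And>x. x \<in> carrier F \<Longrightarrow> \<forall>k. x k \<in> I \<Longrightarrow>
       x \<in> finite_sums F {f (\<epsilon> y) | f y. f \<in> rmod_hom R F F \<and> y \<in> carrier F}"
    and h: "\<And>i l. h i l \<in> rmod_hom R F F" and g: "\<And>i l. g i l \<in> carrier F"
    and AA: "\<And>i. A (A (free_basis R i)) =
       A (free_basis R i) \<oplus>\<^bsub>F\<^esub> (\<Oplus>\<^bsub>F\<^esub>l\<in>{..<n i}. h i l (\<epsilon> (g i l)))"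
    and c: "bij c"
begin

lemma R: "ring R" using M' by (simp add: right_module_def)

lemma F: "right_module R F"
  unfolding F_def by (rule free_rmodule_right_module[OF R])

lemma basis: "free_basis R i \<in> carrier F"
  unfolding F_def by (rule free_basis_closed[OF R UNIV_I])

sublocale F: right_module R F by (rule F)
sublocale M': right_module R M' by (rule M')

definition "\<iota> k = copow_in R c (Inl k)"
definition "\<omega> m = copow_in R c (Inr m)"
definition "out N f f' = copow_out R N c (case_sum f f')"

lemma \<iota>: "\<iota> k \<in> rmod_hom R F F" and \<omega>: "\<omega> m \<in> rmod_hom R F F"
  unfolding \<iota>_def \<omega>_def using copow_in_hom[OF R c, folded F_def] by auto

lemma case_sum_hom:
  "(\<And>k. f k \<in> rmod_hom R F N) \<Longrightarrow> (\<And>m. f' m \<in> rmod_hom R F N) \<Longrightarrow> case_sum f f' z \<in> rmod_hom R F N"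
  by (cases z) auto

lemma
  assumes N: "right_module R N" and f: "\<And>k. f k \<in> rmod_hom R F N" "\<And>m. f' m \<in> rmod_hom R F N"
  shows out_hom: "out N f f' \<in> rmod_hom R F N"
    and out_\<iota>: "x \<in> carrier F \<Longrightarrow> out N f f' (\<iota> k x) = f k x"
    and out_\<omega>: "x \<in> carrier F \<Longrightarrow> out N f f' (\<omega> m x) = f' m x"
proof -
  have *: "case_sum f f' z \<in> rmod_hom R F N" for z by (rule case_sum_hom[OF f])
  show "out N f f' \<in> rmod_hom R F N"
    unfolding out_def by (rule copow_out_hom[OF R c, folded F_def, OF N *])
  show "out N f f' (\<iota> k x) = f k x" if "x \<in> carrier F"
    unfolding out_def \<iota>_def using copow_out_in[OF R c, folded F_def, OF N * that, where z = "Inl k"] by simp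
  show "out N f f' (\<omega> m x) = f' m x" if "x \<in> carrier F"
    unfolding out_def \<omega>_def using copow_out_in[OF R c, folded F_def, OF N * that, where z = "Inr m"] by simp
qed

text \<open>The equation for \<open>\<phi>\<close> is a premise so that one instantiation with a
  definition yields the homomorphism property and both component rules of the defined
  constant.\<close>

lemma out_rules:
  assumes "right_module R N" "\<And>k. f k \<in> rmod_hom R F N" "\<And>m. f' m \<in> rmod_hom R F N" "\<phi> = out N f f'"
  shows "\<phi> \<in> rmod_hom R F N" "x \<in> carrier F \<Longrightarrow> \<phi> (\<iota> k x) = f k x"
    "x \<in> carrier F \<Longrightarrow> \<phi> (\<omega> m x) = f' m x"
  unfolding assms(4)
  by (rule out_hom[OF assms(1-3)], rule out_\<iota>[OF assms(1-3)], assumption,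
      rule out_\<omega>[OF assms(1-3)], assumption)

lemma hom_ext:
  assumes "right_module R N" "f \<in> rmod_hom R F N" "f' \<in> rmod_hom R F N"
    and "\<And>k x. x \<in> carrier F \<Longrightarrow> f (\<iota> k x) = f' (\<iota> k x)"
    and "\<And>m x. x \<in> carrier F \<Longrightarrow> f (\<omega> m x) = f' (\<omega> m x)"
    and "y \<in> carrier F"
  shows "f y = f' y"
proof (rule copow_ext[OF R c, folded F_def, OF assms(1,2,3) _ assms(6)])
  fix z x assume "x \<in> carrier F"
  then show "f (copow_in R c z x) = f' (copow_in R c z x)"
    using assms(4,5) by (cases z) (auto simp: \<iota>_def \<omega>_def)
qed

lemma basis_ext:
  assumes "right_module R N" "f \<in> rmod_hom R F N" "f' \<in> rmod_hom R F N"
    and "\<And>i. f (free_basis R i) = f' (free_basis R i)" and "y \<in> carrier F"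
  shows "f y = f' y"
  using free_hom_ext[of R N f UNIV f' y] assms by (simp add: F_def)

text \<open>The sum of \<open>\<iota> 1\<close> up to \<open>\<iota> k\<close>, empty for
  \<open>k = 0\<close>. Its increment \<open>\<iota> (Suc k)\<close> is what lets \<open>r\<close>
  undo the passage of \<open>j\<close> to the next stage.\<close>

primrec D :: "nat \<Rightarrow> (nat \<Rightarrow> 'a) \<Rightarrow> nat \<Rightarrow> 'a" where
  "D 0 = (\<lambda>_. \<zero>\<^bsub>F\<^esub>)"
| "D (Suc k) = (\<lambda>x. D k x \<oplus>\<^bsub>F\<^esub> \<iota> (Suc k) x)"

text \<open>Column \<open>i\<close> of \<open>A\<^sup>2 - A\<close> is the sum of the vectors
  \<open>h i l (\<epsilon> (g i l))\<close>. \<open>u k\<close> stores each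
  \<open>\<epsilon> (g i l)\<close> in a copy of its own, and applying \<open>h i l\<close> there
  restores the column.\<close>

definition "u k = free_eval R F (\<lambda>i. \<Oplus>\<^bsub>F\<^esub>l\<in>{..<n i}. \<omega> (Some (k, i, l)) (\<epsilon> (g i l)))"

text \<open>The projection onto all stages together with the copies of \<open>Q\<close> cut out by
  \<open>\<epsilon>\<close>; its image carries the generators of \<open>P\<close>.\<close>

definition "\<kappa> = out F \<iota> (\<lambda>m x. \<omega> m (\<epsilon> x))"

text \<open>The relations of the colimit: \<open>x\<close> at stage \<open>k\<close> is identified
  with \<open>A x\<close> at stage \<open>k + 1\<close> plus \<open>u k x\<close> in the copies of
  \<open>Q\<close>.\<close>

definition "j = out F (\<lambda>k x. (\<iota> k x \<ominus>\<^bsub>F\<^esub> \<iota> (Suc k) (A x)) \<ominus>\<^bsub>F\<^esub> u k x) (\<lambda>_ _. \<zero>\<^bsub>F\<^esub>)"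

text \<open>
  Writing \<open>\<iota>\<^sub>k \<mapsto> \<rho>\<^sub>k\<close> and \<open>- \<tau>\<^sub>k v\<close> on the copies belonging to stage \<open>k\<close>, the equation \<open>r j \<iota>\<^sub>k = \<iota>\<^sub>k\<close>
  reads \<open>\<rho>\<^sub>k - \<rho>\<^sub>k\<^sub>+\<^sub>1 A + \<tau>\<^sub>k (A\<^sup>2 - A) = \<iota>\<^sub>k\<close>. The ansatz \<open>\<rho>\<^sub>k = \<iota>\<^sub>k + \<beta>\<^sub>k A\<close> gives \<open>\<tau>\<^sub>k = \<beta>\<^sub>k\<^sub>+\<^sub>1\<close> and
  \<open>\<beta>\<^sub>k - \<beta>\<^sub>k\<^sub>+\<^sub>1 = \<iota>\<^sub>k\<^sub>+\<^sub>1\<close>, solved by \<open>\<beta>\<^sub>k = - D k\<close>.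
\<close>

definition "r = out F (\<lambda>k x. \<iota> k x \<ominus>\<^bsub>F\<^esub> D k (A x))
  (\<lambda>m x. case m of None \<Rightarrow> \<zero>\<^bsub>F\<^esub> | Some (k, i, l) \<Rightarrow> D (Suc k) (h i l (\<epsilon> x)))"

definition "p y = \<kappa> y \<ominus>\<^bsub>F\<^esub> j (r y)"

text \<open>Taking \<open>\<pi>\<close> at every stage respects the relations \<open>j\<close>
  because \<open>\<pi> A = \<pi>\<close>.\<close>

definition "\<Phi> = out M' (\<lambda>_. \<pi>) (\<lambda>_ _. \<zero>\<^bsub>M'\<^esub>)"

section \<open>Homomorphism properties and values on the copies\<close>

lemma D: "D k \<in> rmod_hom R F F"
proof (induction k)
  case 0
  show ?case using rmod_hom_zero_map[OF F] by simp
next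
  case (Suc k)
  then show ?case using rmod_hom_add[OF F Suc \<iota>] by simp
qed

lemma closed [simp]:
  assumes "x \<in> carrier F"
  shows "\<iota> k x \<in> carrier F" "\<omega> m x \<in> carrier F" "A x \<in> carrier F" "\<epsilon> x \<in> carrier F"
    "D k x \<in> carrier F" "h i l x \<in> carrier F" "\<pi> x \<in> carrier M'"
  using assms by (rule rmod_homD(1)[OF \<iota>] rmod_homD(1)[OF \<omega>] rmod_homD(1)[OF A] rmod_homD(1)[OF \<epsilon>]
      rmod_homD(1)[OF D] rmod_homD(1)[OF h] rmod_homD(1)[OF \<pi>])+

lemma summand_closed: "\<omega> (Some (k, i, l)) (\<epsilon> (g i l)) \<in> carrier F"
  using g by simp

lemma u_basis: "u k (free_basis R i) = (\<Oplus>\<^bsub>F\<^esub>l\<in>{..<n i}. \<omega> (Some (k, i, l)) (\<epsilon> (g i l)))"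
  unfolding u_def by (rule free_eval_basis[OF F]) (use summand_closed in \<open>auto intro!: F.M.finsum_closed\<close>)

lemma u: "u k \<in> rmod_hom R F F"
proof -
  have "(\<Oplus>\<^bsub>F\<^esub>l\<in>{..<n i}. \<omega> (Some (k, i, l)) (\<epsilon> (g i l))) \<in> carrier F" for i
    by (rule F.M.finsum_closed) (use summand_closed in auto)
  then show ?thesis
    unfolding u_def by (intro free_eval_hom[OF F, where X = "UNIV :: nat set", folded F_def])
qed

lemma hom_u_basis:
  assumes "right_module R N" "f \<in> rmod_hom R F N"
  shows "f (u k (free_basis R i)) = (\<Oplus>\<^bsub>N\<^esub>l\<in>{..<n i}. f (\<omega> (Some (k, i, l)) (\<epsilon> (g i l))))"
  unfolding u_basis by (rule rmod_hom_finsum[OF F assms]) (use summand_closed in auto)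

lemma u_closed [simp]: "x \<in> carrier F \<Longrightarrow> u k x \<in> carrier F"
  using rmod_homD(1)[OF u] .

lemma \<kappa>_parts: "\<iota> k \<in> rmod_hom R F F" "(\<lambda>x. \<omega> m (\<epsilon> x)) \<in> rmod_hom R F F"
  by (rule \<iota>, rule rmod_hom_comp[OF \<epsilon> \<omega>])

lemma j_parts:
  "(\<lambda>x. (\<iota> k x \<ominus>\<^bsub>F\<^esub> \<iota> (Suc k) (A x)) \<ominus>\<^bsub>F\<^esub> u k x) \<in> rmod_hom R F F"
  "(\<lambda>_. \<zero>\<^bsub>F\<^esub>) \<in> rmod_hom R F F"
  by (rule rmod_hom_minus[OF F rmod_hom_minus[OF F \<iota> rmod_hom_comp[OF A \<iota>]] u],
      rule rmod_hom_zero_map[OF F])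

lemma r_parts:
  "(\<lambda>x. \<iota> k x \<ominus>\<^bsub>F\<^esub> D k (A x)) \<in> rmod_hom R F F"
  "(\<lambda>x. case m of None \<Rightarrow> \<zero>\<^bsub>F\<^esub> | Some (k, i, l) \<Rightarrow> D (Suc k) (h i l (\<epsilon> x))) \<in> rmod_hom R F F"
proof -
  show "(\<lambda>x. \<iota> k x \<ominus>\<^bsub>F\<^esub> D k (A x)) \<in> rmod_hom R F F"
    by (rule rmod_hom_minus[OF F \<iota> rmod_hom_comp[OF A D]])
  have "(\<lambda>x. D (Suc k) (h i l (\<epsilon> x))) \<in> rmod_hom R F F" for k i l
    by (rule rmod_hom_comp[OF rmod_hom_comp[OF \<epsilon> h] D])
  then show "(\<lambda>x. case m of None \<Rightarrow> \<zero>\<^bsub>F\<^esub> | Some (k, i, l) \<Rightarrow> D (Suc k) (h i l (\<epsilon> x))) \<in> rmod_hom R F F"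
    using rmod_hom_zero_map[OF F] by (cases m) (auto simp del: D.simps)
qed

lemma \<Phi>_parts: "\<pi> \<in> rmod_hom R F M'" "(\<lambda>_. \<zero>\<^bsub>M'\<^esub>) \<in> rmod_hom R F M'"
  by (rule \<pi>, rule rmod_hom_zero_map[OF M'])

lemmas \<kappa>_rules = out_rules[OF F _ _ \<kappa>_def, OF \<kappa>_parts]
lemmas j_rules = out_rules[OF F _ _ j_def, OF j_parts]
lemmas r_rules = out_rules[OF F _ _ r_def, OF r_parts]
lemmas \<Phi>_rules = out_rules[OF M' _ _ \<Phi>_def, OF \<Phi>_parts]
lemmas \<kappa> = \<kappa>_rules(1) and \<kappa>_at = \<kappa>_rules(2,3)
lemmas j = j_rules(1) and j_at = j_rules(2,3)
lemmas r = r_rules(1) and r_at = r_rules(2,3)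
lemmas \<Phi> = \<Phi>_rules(1) and \<Phi>_at = \<Phi>_rules(2,3)

lemma p: "p \<in> rmod_hom R F F"
  unfolding p_def[abs_def] by (rule rmod_hom_minus[OF F \<kappa> rmod_hom_comp[OF r j]])

lemma closed' [simp]:
  assumes "x \<in> carrier F"
  shows "\<kappa> x \<in> carrier F" "j x \<in> carrier F" "r x \<in> carrier F" "p x \<in> carrier F" "\<Phi> x \<in> carrier M'"
  using assms by (rule rmod_homD(1)[OF \<kappa>] rmod_homD(1)[OF j] rmod_homD(1)[OF r] rmod_homD(1)[OF p]
      rmod_homD(1)[OF \<Phi>])+

section \<open>The splitting of \<open>j\<close> and the idempotent \<open>p\<close>\<close>

lemma \<kappa>_u:
  assumes x: "x \<in> carrier F" shows "\<kappa> (u k x) = u k x"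
proof (rule basis_ext[OF F rmod_hom_comp[OF u \<kappa>] u _ x])
  fix i
  show "\<kappa> (u k (free_basis R i)) = u k (free_basis R i)"
    unfolding hom_u_basis[OF F \<kappa>] using g by (simp add: u_basis \<kappa>_at \<epsilon>\<epsilon>)
qed

text \<open>\<open>r\<close> applies \<open>h i l\<close> and then \<open>D (Suc k)\<close> to the
  vectors stored by \<open>u k\<close>, which reassembles \<open>A\<^sup>2 - A\<close> column by
  column.\<close>

lemma r_u:
  assumes x: "x \<in> carrier F"
  shows "D (Suc k) (A (A x)) = D (Suc k) (A x) \<oplus>\<^bsub>F\<^esub> r (u k x)"
proof (rule basis_ext[OF F _ _ _ x])
  show "(\<lambda>x. D (Suc k) (A (A x))) \<in> rmod_hom R F F"
    by (rule rmod_hom_comp[OF rmod_hom_comp[OF A A] D])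
  show "(\<lambda>x. D (Suc k) (A x) \<oplus>\<^bsub>F\<^esub> r (u k x)) \<in> rmod_hom R F F"
    by (rule rmod_hom_add[OF F rmod_hom_comp[OF A D] rmod_hom_comp[OF u r]])
  fix i
  have "r (u k (free_basis R i)) = (\<Oplus>\<^bsub>F\<^esub>l\<in>{..<n i}. D (Suc k) (h i l (\<epsilon> (g i l))))"
    using g by (simp add: hom_u_basis[OF F r] r_at \<epsilon>\<epsilon> del: D.simps)
  also have "\<dots> = D (Suc k) (\<Oplus>\<^bsub>F\<^esub>l\<in>{..<n i}. h i l (\<epsilon> (g i l)))"
    by (rule rmod_hom_finsum[OF F F D, symmetric]) (use g in auto)
  moreover have "(\<Oplus>\<^bsub>F\<^esub>l\<in>{..<n i}. h i l (\<epsilon> (g i l))) \<in> carrier F"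
    using g by (auto intro!: F.M.finsum_closed)
  ultimately show "D (Suc k) (A (A (free_basis R i)))
      = D (Suc k) (A (free_basis R i)) \<oplus>\<^bsub>F\<^esub> r (u k (free_basis R i))"
    using rmod_homD(2)[OF D] basis by (simp add: AA del: D.simps)
qed

lemma r_j_\<iota>:
  assumes x: "x \<in> carrier F"
  shows "r (j (\<iota> k x)) = \<iota> k x"
proof -
  let ?d = "D k (A x)" and ?w = "\<iota> (Suc k) (A x)" and ?v = "D (Suc k) (A (A x))"
  have cl: "?d \<in> carrier F" "?w \<in> carrier F" "?v \<in> carrier F" "r (u k x) \<in> carrier F"
    "?d \<oplus>\<^bsub>F\<^esub> ?w \<in> carrier F"
    using x by (simp_all del: D.simps)
  \<comment> \<open>\<open>D (Suc k) (A x)\<close> unfolds to \<open>?d\<close> plus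
    \<open>?w\<close>, which turns \<open>r_u\<close> into a formula for
    \<open>r (u k x)\<close>.\<close>
  have "?v = r (u k x) \<oplus>\<^bsub>F\<^esub> (?d \<oplus>\<^bsub>F\<^esub> ?w)"
    using r_u[OF x, of k] F.M.a_comm[OF cl(4,5)] by simp
  then have ru: "r (u k x) = ?v \<ominus>\<^bsub>F\<^esub> (?d \<oplus>\<^bsub>F\<^esub> ?w)"
    using cl(4,5) by (simp add: F.M.minus_eq F.M.a_assoc F.M.r_neg del: D.simps)
  have "r (j (\<iota> k x)) = (r (\<iota> k x) \<ominus>\<^bsub>F\<^esub> r ?w) \<ominus>\<^bsub>F\<^esub> r (u k x)"
    using x by (simp add: j_at rmod_hom_minus_apply[OF F F r])
  also have "\<dots> = ((\<iota> k x \<ominus>\<^bsub>F\<^esub> ?d) \<ominus>\<^bsub>F\<^esub> (?w \<ominus>\<^bsub>F\<^esub> ?v)) \<ominus>\<^bsub>F\<^esub> (?v \<ominus>\<^bsub>F\<^esub> (?d \<oplus>\<^bsub>F\<^esub> ?w))"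
    unfolding ru using x by (simp add: r_at del: D.simps)
  also have "\<dots> = \<iota> k x"
    by (rule F.M.telescope_cancel) (use x cl in auto)
  finally show ?thesis .
qed

lemmas F_zero = rmod_hom_zero[OF F F]

text \<open>On the stages, \<open>\<kappa>\<close> fixes the values of \<open>j\<close> and
  \<open>r_j_\<iota>\<close> gives \<open>j r j = j\<close>; on the other copies \<open>j\<close> is
  zero.\<close>

lemma p_j: 
  assumes y: "y \<in> carrier F" shows "p (j y) = \<zero>\<^bsub>F\<^esub>"
proof (rule hom_ext[OF F rmod_hom_comp[OF j p] rmod_hom_zero_map[OF F] _ _ y])
  fix k x assume x: "x \<in> carrier F"
  have "\<kappa> (j (\<iota> k x)) = j (\<iota> k x)"
    using x by (simp add: j_at \<kappa>_at rmod_hom_minus_apply[OF F F \<kappa>] \<kappa>_u)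
  then show "p (j (\<iota> k x)) = \<zero>\<^bsub>F\<^esub>"
    using x r_j_\<iota>[OF x] by (simp add: p_def F.M.minus_eq F.M.r_neg)
qed (simp add: j_at F_zero[OF p])

text \<open>\<open>\<kappa>\<close> is idempotent, and \<open>r\<close> agrees at
  \<open>\<omega> m (\<epsilon> x)\<close> and \<open>\<omega> m x\<close> because on these copies
  it either vanishes or applies \<open>\<epsilon>\<close> first.\<close>

lemma p_\<kappa>:
  assumes y: "y \<in> carrier F" shows "p (\<kappa> y) = p y"
proof (rule hom_ext[OF F rmod_hom_comp[OF \<kappa> p] p _ _ y])
  fix m x assume x: "x \<in> carrier F"
  have "r (\<omega> m (\<epsilon> x)) = r (\<omega> m x)"
    using x by (auto simp: r_at \<epsilon>\<epsilon> split: option.split simp del: D.simps)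
  then show "p (\<kappa> (\<omega> m x)) = p (\<omega> m x)"
    using x by (simp add: p_def \<kappa>_at \<epsilon>\<epsilon>)
qed (simp add: \<kappa>_at)

lemma p_idem:
  assumes y: "y \<in> carrier F" shows "p (p y) = p y"
proof -
  have "p (p y) = p (\<kappa> y) \<ominus>\<^bsub>F\<^esub> p (j (r y))"
    using y rmod_hom_minus_apply[OF F F p, of "\<kappa> y" "j (r y)"] by (simp add: p_def[of y])
  then show ?thesis using y by (simp add: p_\<kappa> p_j F.M.minus_eq)
qed

section \<open>The module \<open>P\<close> and its map onto \<open>M'\<close>\<close>

definition "P = F\<lparr>carrier := p ` carrier F\<rparr>"

lemma P_props: "right_module R P" "p \<in> rmod_hom R F P" "projective_rmodule R P"
  "countably_generated_rmodule R P"
proof -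
  note * = idempotent_image[OF R, folded F_def, OF p, folded P_def]
  show "right_module R P" "p \<in> rmod_hom R F P" "projective_rmodule R P" "countably_generated_rmodule R P"
    by (rule *, rule p_idem, assumption)+
qed

lemma P_ops [simp]: "carrier P = p ` carrier F" "x \<oplus>\<^bsub>P\<^esub> y = x \<oplus>\<^bsub>F\<^esub> y" "\<zero>\<^bsub>P\<^esub> = \<zero>\<^bsub>F\<^esub>" "x \<star>\<^bsub>P\<^esub> a = x \<star>\<^bsub>F\<^esub> a"
  by (simp_all add: P_def)

lemma P_hom: "f \<in> rmod_hom R F N \<Longrightarrow> f \<in> rmod_hom R P N"
  unfolding P_def by (rule submodule_incl_hom) auto

text \<open>\<open>\<Phi>\<close> vanishes on the copies of \<open>Q\<close>, so it does not see
  \<open>\<kappa>\<close> or \<open>u\<close>, and \<open>\<pi> A = \<pi>\<close> makes it vanish on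
  the image of \<open>j\<close>.\<close>

lemma \<Phi>_p:
  assumes y: "y \<in> carrier F" shows "\<Phi> (p y) = \<Phi> y"
proof -
  have u0: "\<Phi> (u k x) = \<zero>\<^bsub>M'\<^esub>" if "x \<in> carrier F" for k x
    by (rule basis_ext[OF M' rmod_hom_comp[OF u \<Phi>] \<Phi>_parts(2) _ that])
      (use g in \<open>simp add: hom_u_basis[OF M' \<Phi>] \<Phi>_at\<close>)
  have j0: "\<Phi> (j y) = \<zero>\<^bsub>M'\<^esub>" if "y \<in> carrier F" for y
    by (rule hom_ext[OF M' rmod_hom_comp[OF j \<Phi>] \<Phi>_parts(2) _ _ that])
      (simp_all add: j_at rmod_hom_minus_apply[OF F M' \<Phi>] \<Phi>_at u0 \<pi>A F_zero rmod_hom_zero[OF F M' \<Phi>]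
        M'.M.minus_eq M'.M.r_neg)
  have "\<Phi> (\<kappa> y) = \<Phi> y"
    by (rule hom_ext[OF M' rmod_hom_comp[OF \<kappa> \<Phi>] \<Phi> _ _ y]) (simp_all add: \<kappa>_at \<Phi>_at)
  then show ?thesis
    using y by (simp add: p_def rmod_hom_minus_apply[OF F M' \<Phi>] j0 M'.M.minus_eq)
qed

lemma \<Phi>_surj: "\<Phi> ` carrier P = carrier M'"
proof
  show "carrier M' \<subseteq> \<Phi> ` carrier P"
  proof
    fix v assume "v \<in> carrier M'"
    then obtain x where "x \<in> carrier F" "v = \<pi> x" using \<pi>_surj by blast
    then have "v = \<Phi> (p (\<iota> 0 x))" "\<iota> 0 x \<in> carrier F" by (simp_all add: \<Phi>_p \<Phi>_at)
    then show "v \<in> \<Phi> ` carrier P" by simp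
  qed
qed auto

section \<open>The kernel of \<open>\<Phi>\<close>\<close>

abbreviation "PI \<equiv> rmod_ideal_prod P I"

lemmas PI = rmod_ideal_prod_closed[OF P_props(1) I]
lemmas mem_PI = hom_mem_ideal_prod[OF P_props(1) I, where X = "UNIV :: nat set", folded F_def]

text \<open>This is \<open>W = W I\<close>: \<open>p\<close> takes the same value at
  \<open>\<omega> m x\<close> and \<open>\<omega> m (\<epsilon> x)\<close>, and
  \<open>\<epsilon> x\<close> has entries in \<open>I\<close>.\<close>

lemma p_\<omega>:
  assumes x: "x \<in> carrier F" shows "p (\<omega> m x) \<in> PI"
proof -
  have "p (\<omega> m x) = p (\<omega> m (\<epsilon> x))"
    using p_\<kappa>[of "\<omega> m x"] x by (simp add: \<kappa>_at)
  also have "\<dots> \<in> PI"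
    by (rule mem_PI[OF rmod_hom_comp[OF \<omega> P_props(2)]]) (use x \<epsilon>I in auto)
  finally show ?thesis .
qed

lemmas hom_in = free_hom_in[where R = R and X = "UNIV :: nat set", folded F_def]

lemma p_u:
  assumes x: "x \<in> carrier F" shows "p (u k x) \<in> PI"
proof (rule hom_in[OF P_props(1) rmod_hom_comp[OF u P_props(2)] x PI(1,2,3)])
  interpret P: right_module R P by (rule P_props)
  fix i :: nat
  have "p (u k (free_basis R i)) \<in> PI"
    unfolding hom_u_basis[OF P_props(1,2)]
    by (rule P.M.finsum_in) (use PI p_\<omega> g in auto)
  then show "p (u k (free_basis R i)) \<star>\<^bsub>P\<^esub> x i \<in> PI"
    using PI(5) x by (simp add: F_def free_rmodule_def)
qed auto

text \<open>The relation \<open>j (\<iota> k x)\<close> becomes zero under \<open>p\<close>.\<close>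

lemma p_\<iota>:
  assumes x: "x \<in> carrier F"
  shows "p (\<iota> k x) = p (u k x) \<oplus>\<^bsub>F\<^esub> p (\<iota> (Suc k) (A x))"
proof -
  have "\<zero>\<^bsub>F\<^esub> = (p (\<iota> k x) \<ominus>\<^bsub>F\<^esub> p (\<iota> (Suc k) (A x))) \<ominus>\<^bsub>F\<^esub> p (u k x)"
    using p_j[of "\<iota> k x"] x by (simp add: j_at rmod_hom_minus_apply[OF F F p])
  then show ?thesis using x by (intro F.M.eq_add_if_minus_minus_zero) simp_all
qed

lemma p_\<iota>_shift:
  assumes x: "x \<in> carrier F" and "k \<le> m"
  shows "\<exists>x'\<in>carrier F. \<exists>z\<in>PI. p (\<iota> k x) = z \<oplus>\<^bsub>F\<^esub> p (\<iota> m x')"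
  using \<open>k \<le> m\<close>
proof (induction m rule: dec_induct)
  case base
  show ?case using x PI(2) by (intro bexI[of _ x] bexI[of _ "\<zero>\<^bsub>F\<^esub>"]) auto
next
  case (step m)
  then obtain x' z where xz: "x' \<in> carrier F" "z \<in> PI" "p (\<iota> k x) = z \<oplus>\<^bsub>F\<^esub> p (\<iota> m x')" by blast
  have zF: "z \<in> carrier F" using PI(1) xz(2) by auto
  have "p (\<iota> k x) = (z \<oplus>\<^bsub>F\<^esub> p (u m x')) \<oplus>\<^bsub>F\<^esub> p (\<iota> (Suc m) (A x'))"
    using xz zF p_\<iota>[OF xz(1), of m] by (simp add: F.M.a_assoc)
  moreover have "z \<oplus>\<^bsub>F\<^esub> p (u m x') \<in> PI" using PI(3)[OF xz(2) p_u[OF xz(1)]] by simp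
  ultimately show ?case using xz(1) closed(3) by blast
qed

text \<open>Modulo \<open>PI\<close> only the stages remain, and \<open>p_\<iota>_shift\<close>
  moves an element to any later stage. Asking for all large \<open>m\<close> lets two summands be
  brought to a common stage.\<close>

lemma p_eventually_\<iota>:
  assumes y: "y \<in> carrier F"
  shows "\<exists>N. \<forall>m\<ge>N. \<exists>x\<in>carrier F. \<exists>z\<in>PI. p y = z \<oplus>\<^bsub>F\<^esub> p (\<iota> m x)"
proof -
  define S where "S = {v \<in> carrier P. \<exists>N. \<forall>m\<ge>N. \<exists>x\<in>carrier F. \<exists>z\<in>PI. v = z \<oplus>\<^bsub>F\<^esub> p (\<iota> m x)}"
  interpret P: right_module R P by (rule P_props)
  have \<iota>0: "p (\<iota> m \<zero>\<^bsub>F\<^esub>) = \<zero>\<^bsub>F\<^esub>" for m by (simp add: F_zero[OF p] F_zero[OF \<iota>])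
  have PIF: "PI \<subseteq> carrier F" using PI(1) by auto
  have PIS: "PI \<subseteq> S"
  proof
    fix z assume z: "z \<in> PI"
    then have "z \<in> carrier F" using PIF by auto
    then have "z = z \<oplus>\<^bsub>F\<^esub> p (\<iota> m \<zero>\<^bsub>F\<^esub>)" for m by (simp add: \<iota>0)
    then show "z \<in> S" using z PI(1) F.M.zero_closed unfolding S_def by blast
  qed
  have "p y \<in> S"
  proof (rule copow_hom_in[OF R c, folded F_def, OF P_props(1,2) _ _ _ _ y])
    show "S \<subseteq> carrier P" by (auto simp: S_def)
    show "\<zero>\<^bsub>P\<^esub> \<in> S" using PIS PI(2) by auto
  next
    fix v w assume v: "v \<in> S" and w: "w \<in> S"
    obtain N where N: "\<And>m. m \<ge> N \<Longrightarrow> \<exists>x\<in>carrier F. \<exists>z\<in>PI. v = z \<oplus>\<^bsub>F\<^esub> p (\<iota> m x)"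
      using v unfolding S_def by blast
    obtain K where K: "\<And>m. m \<ge> K \<Longrightarrow> \<exists>x\<in>carrier F. \<exists>z\<in>PI. w = z \<oplus>\<^bsub>F\<^esub> p (\<iota> m x)"
      using w unfolding S_def by blast
    have "\<exists>x\<in>carrier F. \<exists>z\<in>PI. v \<oplus>\<^bsub>F\<^esub> w = z \<oplus>\<^bsub>F\<^esub> p (\<iota> m x)" if m: "m \<ge> max N K" for m
    proof -
      obtain x z where xz: "x \<in> carrier F" "z \<in> PI" "v = z \<oplus>\<^bsub>F\<^esub> p (\<iota> m x)" using N[of m] m by auto
      obtain x' z' where xz': "x' \<in> carrier F" "z' \<in> PI" "w = z' \<oplus>\<^bsub>F\<^esub> p (\<iota> m x')" using K[of m] m by auto
      have zF: "z \<in> carrier F" "z' \<in> carrier F" using PIF xz xz' by auto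
      have "v \<oplus>\<^bsub>F\<^esub> w = (z \<oplus>\<^bsub>F\<^esub> z') \<oplus>\<^bsub>F\<^esub> p (\<iota> m (x \<oplus>\<^bsub>F\<^esub> x'))"
        using xz xz' zF rmod_homD(2)[OF p] rmod_homD(2)[OF \<iota>] by (simp add: F.M.a_ac)
      moreover have "z \<oplus>\<^bsub>F\<^esub> z' \<in> PI" using PI(3)[OF xz(2) xz'(2)] by simp
      ultimately show ?thesis using xz(1) xz'(1) by blast
    qed
    moreover have "v \<oplus>\<^bsub>P\<^esub> w \<in> carrier P" using v w by (intro P.M.a_closed) (auto simp: S_def)
    ultimately show "v \<oplus>\<^bsub>P\<^esub> w \<in> S"
      unfolding S_def P_ops(2) by (intro CollectI conjI exI[of _ "max N K"] allI impI)
  next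
    fix z x assume x: "x \<in> carrier F"
    show "p (copow_in R c z x) \<in> S"
    proof (cases z)
      case (Inl k)
      have "p (\<iota> k x) \<in> S"
        unfolding S_def using x p_\<iota>_shift[OF x, of k]
        by (intro CollectI conjI exI[of _ k] allI impI) simp_all
      then show ?thesis by (simp add: Inl \<iota>_def)
    next
      case (Inr m)
      have "p (\<omega> m x) \<in> S" using p_\<omega>[OF x] PIS by auto
      then show ?thesis by (simp add: Inr \<omega>_def)
    qed
  qed
  then show ?thesis unfolding S_def by blast
qed

lemma \<Phi>_PI:
  assumes "z \<in> PI" shows "\<Phi> z = \<zero>\<^bsub>M'\<^esub>"
  using assms[unfolded rmod_ideal_prod_def] right_module_abelian_monoid[OF P_props(1)]
proof (induction rule: finite_sums_induct)
  interpret I: ideal I R by (rule I)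
  interpret P: right_module R P by (rule P_props)
  case (mem y)
  then obtain v a where va: "y = v \<star>\<^bsub>P\<^esub> a" "v \<in> carrier P" "a \<in> I" by blast
  have a: "a \<in> carrier R" using va(3) I.a_subset by auto
  have v: "v \<in> carrier F" using va(2) by auto
  have "y \<in> carrier P" unfolding va(1) by (rule P.rsmult_closed[OF va(2) a])
  then show ?case using va v a rmod_homD(3)[OF \<Phi> v a] M'I[of "\<Phi> v" a] by simp
next
  case zero
  show ?case using rmod_hom_zero[OF F M' \<Phi>] by simp
next
  case (add x y)
  then show ?case using rmod_homD(2)[OF \<Phi>, of x y] by auto
qed

text \<open>Modulo \<open>PI\<close>, \<open>y\<close> is represented at some stage \<open>m\<close>
  by an \<open>x\<close> with \<open>\<pi> x\<close> zero. One further step replaces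
  \<open>x\<close> by \<open>A x\<close>, whose entries lie in \<open>I\<close>.\<close>

lemma \<Phi>_ker:
  assumes y: "y \<in> carrier P" and 0: "\<Phi> y = \<zero>\<^bsub>M'\<^esub>"
  shows "y \<in> PI"
proof -
  obtain y' where y': "y' \<in> carrier F" "y = p y'" using y by auto
  obtain m x z where xz: "x \<in> carrier F" "z \<in> PI" "y = z \<oplus>\<^bsub>F\<^esub> p (\<iota> m x)"
    using p_eventually_\<iota>[OF y'(1)] y'(2) by blast
  have zF: "z \<in> carrier F" using PI(1) xz(2) by auto
  have "\<Phi> y = \<pi> x"
    using xz zF rmod_homD(2)[OF \<Phi>] by (simp add: \<Phi>_PI \<Phi>_p \<Phi>_at)
  then have "A x k \<in> I" for k using A_ker[OF xz(1)] 0 by simp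
  then have "p (\<iota> (Suc m) (A x)) \<in> PI"
    using xz(1) by (intro mem_PI[OF rmod_hom_comp[OF \<iota> P_props(2)]]) auto
  then have "p (\<iota> m x) \<in> PI" using PI(3)[OF p_u[OF xz(1)]] p_\<iota>[OF xz(1)] by simp
  then show ?thesis using PI(3)[OF xz(2)] xz(3) by simp
qed

section \<open>The spare copy of \<open>Q\<close> and the trace of \<open>P\<close>\<close>

definition "\<rho> = out F (\<lambda>_ _. \<zero>\<^bsub>F\<^esub>) (case_option (\<lambda>x. x) (\<lambda>_ _. \<zero>\<^bsub>F\<^esub>))"

lemma \<rho>_parts:
  "(\<lambda>_. \<zero>\<^bsub>F\<^esub>) \<in> rmod_hom R F F" "case_option (\<lambda>x. x) (\<lambda>_ _. \<zero>\<^bsub>F\<^esub>) m \<in> rmod_hom R F F"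
  by (rule rmod_hom_zero_map[OF F], cases m)
    (simp_all only: option.case rmod_hom_zero_map[OF F] rmod_hom_id)

lemmas \<rho>_rules = out_rules[OF F _ _ \<rho>_def, OF \<rho>_parts]
lemmas \<rho> = \<rho>_rules(1) and \<rho>_at = \<rho>_rules(2,3)

text \<open>\<open>r\<close> vanishes on the spare copy \<open>None\<close>, so \<open>p\<close>
  acts there as \<open>\<epsilon>\<close>. Projecting by \<open>\<rho>\<close>, applying an
  endomorphism \<open>f\<close> and taking coordinate 0 gives functionals on \<open>P\<close> that
  attain coordinate 0 of every \<open>f (\<epsilon> y)\<close>.\<close>

lemma I_subset_trace: "I \<subseteq> trace_ideal R P"
proof
  interpret I: ideal I R by (rule I)
  let ?X = "\<Union>f\<in>rmod_hom R P (regular_rmodule R). f ` carrier P"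
  have X: "?X \<subseteq> carrier R" by (auto simp: rmod_hom_def regular_rmodule_def)
  note amR = F.R.abelian_monoid_axioms
  have "x 0 \<in> finite_sums R ?X"
    if "x \<in> finite_sums F {f (\<epsilon> y) | f y. f \<in> rmod_hom R F F \<and> y \<in> carrier F}" for x
    using that F.M.abelian_monoid_axioms
  proof (induction rule: finite_sums_induct)
    case (mem x)
    then obtain f y where f: "f \<in> rmod_hom R F F" and y: "y \<in> carrier F" and x: "x = f (\<epsilon> y)" by blast
    have "p (\<omega> None y) = \<omega> None (\<epsilon> y)"
      using y by (simp add: p_def \<kappa>_at r_at F_zero[OF j] F.M.minus_eq)
    then have "f (\<rho> (p (\<omega> None y))) 0 = x 0" using y x by (simp add: \<rho>_at)
    moreover have "(\<lambda>v. f (\<rho> v) 0) \<in> rmod_hom R P (regular_rmodule R)"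
      by (rule P_hom, rule rmod_hom_comp[OF rmod_hom_comp[OF \<rho> f]
          free_coord_hom[where R = R and X = "UNIV :: nat set", folded F_def]])
    moreover have "p (\<omega> None y) \<in> carrier P" using y by simp
    ultimately have "x 0 \<in> ?X" by (intro UN_I[of "\<lambda>v. f (\<rho> v) 0"]) (auto intro: rev_image_eqI)
    moreover have "x \<in> carrier F" using rmod_homD(1)[OF f] x y by simp
    ultimately show ?case using finite_sums_incl[OF amR X] by blast
  next
    case zero
    then show ?case using finite_sums_zero[OF amR, of ?X] by (simp add: F_def free_rmodule_def)
  next
    case (add x y)
    then show ?case using finite_sums_add[OF amR X, of "x 0" "y 0"] by (simp add: F_def free_rmodule_def)
  qed
  note mem = this
  fix a assume a: "a \<in> I"
  then have aR: "a \<in> carrier R" using I.a_subset by auto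
  \<comment> \<open>By \<open>gen\<close> the vector with sole entry \<open>a\<close> is a sum of
    values \<open>f (\<epsilon> y)\<close>; its coordinate 0 recovers \<open>a\<close>.\<close>
  let ?x = "free_basis R (0::nat) \<star>\<^bsub>F\<^esub> a"
  have x: "?x k = (if k = 0 then a else \<zero>\<^bsub>R\<^esub>)" for k
    using aR by (simp add: F_def free_rmodule_def free_basis_def)
  have "?x \<in> carrier F" by (rule F.rsmult_closed[OF basis aR])
  moreover have "\<forall>k. ?x k \<in> I" using a x additive_subgroup.zero_closed[OF ideal.axioms(1)[OF I]] by simp
  ultimately have "?x 0 \<in> finite_sums R ?X" by (intro mem gen)
  then show "a \<in> trace_ideal R P" unfolding trace_ideal_def using x by simp
qed

end

section \<open>Choice of the data and assembly\<close>

lemma countable_copower_index: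
  obtains c :: "(nat + (nat \<times> nat \<times> nat) option) \<times> nat \<Rightarrow> nat" where "bij c"
proof -
  have "infinite (UNIV :: ((nat + (nat \<times> nat \<times> nat) option) \<times> nat) set)"
    by (simp add: finite_prod)
  then show ?thesis using countableE_infinite[of "UNIV :: ((nat + (nat \<times> nat \<times> nat) option) \<times> nat) set"] that
    by auto
qed

theorem theorem3p1:
  fixes R :: "('a, 'r) ring_scheme" and I :: "'a set"
    and Q :: "('a, 'c) rmodule" and P' :: "('a set, 'b) rmodule"
  assumes "ring R" and "ideal I R"
    and "projective_rmodule R Q" and "countably_generated_rmodule R Q"
    and "I = trace_ideal R Q"
    and "projective_rmodule (R Quot I) P'" and "countably_generated_rmodule (R Quot I) P'"
  shows "\<exists>P :: ('a, nat \<Rightarrow> 'a) rmodule.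
    projective_rmodule R P \<and> countably_generated_rmodule R P \<and>
    I \<subseteq> trace_ideal R P \<and>
    rmod_iso (R Quot I) (quot_rmodule P I) P' \<and>
    (\<lambda>t. I +>\<^bsub>R\<^esub> t) ` trace_ideal R P = trace_ideal (R Quot I) P'"
proof -
  define F where "F = free_rmodule R (UNIV :: nat set)"
  interpret I: ideal I R by fact
  have F: "right_module R F" unfolding F_def by (rule free_rmodule_right_module[OF assms(1)])
  interpret F: right_module R F by (rule F)
  have P': "right_module (R Quot I) P'" using assms(6) by (simp add: projective_rmodule_def)
  interpret P': right_module "R Quot I" P' by (rule P')
  let ?M = "restrict_scalars (\<lambda>t. I +>\<^bsub>R\<^esub> t) P'"
  have M: "right_module R ?M" by (rule restrict_scalars_right_module[OF assms(1) P' I.rcos_ring_hom])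
  interpret M: right_module R ?M by (rule M)
  have basis: "free_basis R i \<in> carrier F" for i unfolding F_def by (rule free_basis_closed[OF assms(1)]) simp
  obtain \<epsilon> where \<epsilon>: "\<epsilon> \<in> rmod_hom R F F" "\<And>x. x \<in> carrier F \<Longrightarrow> \<epsilon> (\<epsilon> x) = \<epsilon> x"
    "\<And>x k. x \<in> carrier F \<Longrightarrow> \<epsilon> x k \<in> I"
    and gen: "\<And>x. x \<in> carrier F \<Longrightarrow> \<forall>k. x k \<in> I \<Longrightarrow>
       x \<in> finite_sums F {h (\<epsilon> g) | h g. h \<in> rmod_hom R F F \<and> g \<in> carrier F}"
    by (rule trace_ideal_idempotent[OF assms(3,4), folded F_def assms(5)]) (rule that)
  obtain \<pi> A where \<pi>: "\<pi> \<in> rmod_hom R F ?M" "\<pi> ` carrier F = carrier P'" and A: "A \<in> rmod_hom R F F"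
    "\<And>x. x \<in> carrier F \<Longrightarrow> \<pi> (A x) = \<pi> x"
    "\<And>x k. x \<in> carrier F \<Longrightarrow> \<pi> x = \<zero>\<^bsub>P'\<^esub> \<Longrightarrow> A x k \<in> I"
    by (rule projective_quotient_lift[OF assms(2,6,7), folded F_def]) (rule that)
  note Ac = rmod_homD(1)[OF A(1)]
  \<comment> \<open>Column \<open>i\<close> of \<open>A\<^sup>2 - A\<close> is factored through
    finitely many copies of \<open>Q\<close>.\<close>
  have "\<exists>n h g. (\<forall>l. h l \<in> rmod_hom R F F \<and> g l \<in> carrier F) \<and>
      A (A (free_basis R i)) = A (free_basis R i) \<oplus>\<^bsub>F\<^esub> (\<Oplus>\<^bsub>F\<^esub>l\<in>{..<n::nat}. h l (\<epsilon> (g l)))" for i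
  proof -
    let ?b = "free_basis R i" and ?e = "A (A (free_basis R i) \<ominus>\<^bsub>F\<^esub> free_basis R i)"
    have d: "A ?b \<ominus>\<^bsub>F\<^esub> ?b \<in> carrier F" using basis Ac by simp
    \<comment> \<open>Since \<open>\<pi> A = \<pi>\<close>, the difference of \<open>A ?b\<close>
      and \<open>?b\<close> lies in the kernel of \<open>\<pi>\<close>, so \<open>A\<close> maps it
      to a vector with entries in \<open>I\<close>.\<close>
    have "\<pi> (A ?b \<ominus>\<^bsub>F\<^esub> ?b) = \<zero>\<^bsub>P'\<^esub>"
      using rmod_hom_minus_apply[OF F M \<pi>(1) Ac[OF basis] basis] A(2)[OF basis]
        rmod_homD(1)[OF \<pi>(1) basis] by (simp add: M.M.minus_eq M.M.r_neg[simplified])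
    then have "\<forall>k. ?e k \<in> I" using A(3)[OF d] by simp
    from gen[OF Ac[OF d] this] obtain n y where
      y: "y \<in> {..<n::nat} \<rightarrow> {h (\<epsilon> g) | h g. h \<in> rmod_hom R F F \<and> g \<in> carrier F}"
        "?e = (\<Oplus>\<^bsub>F\<^esub>l\<in>{..<n}. y l)"
      unfolding finite_sums_def by blast
    \<comment> \<open>From index \<open>n\<close> on, the identity and zero serve as default values,
      so that the families are defined at every \<open>l\<close>.\<close>
    have "\<exists>h g. h \<in> rmod_hom R F F \<and> g \<in> carrier F \<and> (l < n \<longrightarrow> y l = h (\<epsilon> g))" for l
    proof (cases "l < n")
      case True
      then show ?thesis using y(1) by blast
    next
      case False
      then show ?thesis using rmod_hom_id F.M.zero_closed by blast
    qed
    then obtain h g where hg: "\<And>l. h l \<in> rmod_hom R F F" "\<And>l. g l \<in> carrier F"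
      "\<And>l. l < n \<Longrightarrow> y l = h l (\<epsilon> (g l))" by metis
    have e: "?e = (\<Oplus>\<^bsub>F\<^esub>l\<in>{..<n}. h l (\<epsilon> (g l)))"
      unfolding y(2) by (rule F.M.finsum_cong') (use hg rmod_homD(1)[OF hg(1)] rmod_homD(1)[OF \<epsilon>(1)] in auto)
    have "A (A ?b) = A ?b \<oplus>\<^bsub>F\<^esub> ?e"
      unfolding rmod_hom_minus_apply[OF F F A(1) Ac[OF basis] basis]
      using basis Ac by (intro F.M.add_diff_cancel[symmetric]) simp_all
    from this[unfolded e] hg(1,2) show ?thesis
      by (intro exI[of _ n] exI[of _ h] exI[of _ g] conjI allI)
  qed
  then have "\<forall>i. \<exists>n h g. (\<forall>l. h l \<in> rmod_hom R F F \<and> g l \<in> carrier F) \<and>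
      A (A (free_basis R i)) = A (free_basis R i) \<oplus>\<^bsub>F\<^esub> (\<Oplus>\<^bsub>F\<^esub>l\<in>{..<n::nat}. h l (\<epsilon> (g l)))"
    by (rule allI)
  then have "\<exists>n h g. \<forall>i. (\<forall>l. h i l \<in> rmod_hom R F F \<and> g i l \<in> carrier F) \<and>
      A (A (free_basis R i)) = A (free_basis R i) \<oplus>\<^bsub>F\<^esub> (\<Oplus>\<^bsub>F\<^esub>l\<in>{..<n i :: nat}. h i l (\<epsilon> (g i l)))"
    by (simp only: choice_iff)
  then obtain n h g where hg: "\<And>i l. h i l \<in> rmod_hom R F F" "\<And>i l. g i l \<in> carrier F"
      "\<And>i. A (A (free_basis R i)) = A (free_basis R i) \<oplus>\<^bsub>F\<^esub> (\<Oplus>\<^bsub>F\<^esub>l\<in>{..<n i :: nat}. h i l (\<epsilon> (g i l)))"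
    by blast
  obtain c :: "(nat + (nat \<times> nat \<times> nat) option) \<times> nat \<Rightarrow> nat" where c: "bij c"
    by (rule countable_copower_index)
  \<comment> \<open>Elements of \<open>I\<close> act on \<open>P'\<close> through the zero of
    \<open>R Quot I\<close>.\<close>
  have kill: "v \<star>\<^bsub>?M\<^esub> a = \<zero>\<^bsub>?M\<^esub>" if "v \<in> carrier ?M" "a \<in> I" for v a
  proof -
    have "I +>\<^bsub>R\<^esub> a = \<zero>\<^bsub>R Quot I\<^esub>" using that(2) by (simp add: I.a_rcos_const I.FactRing_simps(1))
    then show ?thesis using that by simp
  qed
  have surjM: "\<pi> ` carrier F = carrier ?M" using \<pi>(2) by simp
  have kerM: "A x k \<in> I" if "x \<in> carrier F" "\<pi> x = \<zero>\<^bsub>?M\<^esub>" for x k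
    using A(3)[OF that(1)] that(2) by simp
  have hF: "h i l \<in> rmod_hom R F F" and gF: "g i l \<in> carrier F" for i l
    using hg by auto
  have AA: "A (A (free_basis R i)) =
      A (free_basis R i) \<oplus>\<^bsub>F\<^esub> (\<Oplus>\<^bsub>F\<^esub>l\<in>{..<n i}. h i l (\<epsilon> (g i l)))" for i
    using hg by blast
  interpret L: idempotent_lifting R I ?M \<pi> A \<epsilon> n h g c F
    by (rule idempotent_lifting.intro)
      (fact F_def assms(2) M kill \<pi>(1) surjM A(1,2) kerM \<epsilon> gen hF gF AA c)+
  \<comment> \<open>Restriction of scalars keeps the carrier and the zero of \<open>P'\<close>, so
    the results for \<open>?M\<close> are the hypotheses on \<open>\<Phi>\<close> in the quotient
    lemmas.\<close>
  have ker: "\<And>x. x \<in> carrier L.P \<Longrightarrow> L.\<Phi> x = \<zero>\<^bsub>P'\<^esub> \<Longrightarrow> x \<in> rmod_ideal_prod L.P I"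
    using L.\<Phi>_ker by simp
  have surj: "L.\<Phi> ` carrier L.P = carrier P'" using L.\<Phi>_surj by simp
  note Q = assms(2) L.P_props(1) P' L.P_hom[OF L.\<Phi>] surj ker
  show ?thesis
  proof (intro exI[of _ L.P] conjI L.P_props(3,4) L.I_subset_trace)
    show "rmod_iso (R Quot I) (quot_rmodule L.P I) P'" by (rule quot_rmodule_iso[OF Q])
    show "(\<lambda>t. I +>\<^bsub>R\<^esub> t) ` trace_ideal R L.P = trace_ideal (R Quot I) P'"
      using trace_quotient_subset[OF Q] trace_quotient_supset[OF Q L.P_props(3)] by blast
  qed
qed

end
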